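(* If $\underline{\mathcal C}$ is a cofree $G$-$A$-coring, then the categories $\mathcal M^{\mathcal C_e}$ (right comodules over the $A$-coring $\mathcal C_e$) and $\mathcal M^{G,\underline{\mathcal C}}$ (right $G$-$\underline{\mathcal C}$-comodules) are equivalent.
   Context: $G$ is a group with unit $e$, $A$ is a ring with unit. A $G$-$A$-coring (group coring) $\underline{\mathcal C}$ is a family $(\mathcal C_\alpha)_{\alpha\in G}$ of $A$-bimodules with $A$-bimodule maps $\Delta_{\alpha,\beta}:\mathcal C_{\alpha\beta}\to\mathcal C_\alpha\otimes_A\mathcal C_\beta$ and $\varepsilon:\mathcal C_e\to A$ such that, for all $\alpha,\beta,\gamma\in G$, $(\Delta_{\alpha,\beta}\otimes_A\mathcal C_\gamma)\circ\Delta_{\alpha\beta,\gamma}=(\mathcal C_\alpha\otimes_A\Delta_{\beta,\gamma})\circ\Delta_{\alpha,\beta\gamma}$ and $(\mathcal C_\alpha\otimes_A\varepsilon)\circ\Delta_{\alpha,e}=\mathcal C_\alpha=(\varepsilon\otimes_A\mathcal C_\alpha)\circ\Delta_{e,\alpha}$ (an object also denotes its identity map). Then $\mathcal C_e$ is an $A$-coring with comultiplication $\Delta_{e,e}(c)=c_{(1)}\otimes_Ac_{(2)}$ and counit $\varepsilon$. $\underline{\mathcal C}$ is called cofree if there exist $A$-bimodule isomorphisms $\gamma_\alpha:\mathcal C_e\to\mathcal C_\alpha$ ($\alpha\in G$) such that $\Delta_{\alpha,\beta}(\gamma_{\alpha\beta}(c))=\gamma_\alpha(c_{(1)})\otimes_A\gamma_\beta(c_{(2)})$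 for all $c\in\mathcal C_e$, $\alpha,\beta\in G$. A right $G$-$\underline{\mathcal C}$-comodule is a family $\underline M=(M_\alpha)_{\alpha\in G}$ of right $A$-modules with right $A$-linear maps $\rho_{\alpha,\beta}:M_{\alpha\beta}\to M_\alpha\otimes_A\mathcal C_\beta$ such that $(M_\alpha\otimes_A\Delta_{\beta,\gamma})\circ\rho_{\alpha,\beta\gamma}=(\rho_{\alpha,\beta}\otimes_A\mathcal C_\gamma)\circ\rho_{\alpha\beta,\gamma}$ and $(M_\alpha\otimes_A\varepsilon)\circ\rho_{\alpha,e}=M_\alpha$. Morphisms are families of right $A$-linear maps $f_\alpha:M_\alpha\to N_\alpha$ with $(f_\alpha\otimes_A\mathcal C_\beta)\circ\rho_{\alpha,\beta}=\rho_{\alpha,\beta}\circ f_{\alpha\beta}$. The category is $\mathcal M^{G,\underline{\mathcal C}}$. *)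

theory Defs
  imports "HOL-Algebra.Free_Abelian_Groups" "HOL-Algebra.Generated_Groups" "HOL-Algebra.Ring"
begin

section \<open>Modules and bimodules over a possibly noncommutative ring\<close>

text \<open>
  The additive group of a module is kept in the \<open>monoid\<close> part of the record, because free abelian
  groups, quotients and homomorphisms are phrased for that record type in HOL-Algebra. Hence
  \<open>x \<otimes>\<^bsub>M\<^esub> y\<close> below is the \<^emph>\<open>sum\<close> of two module elements and \<open>\<one>\<^bsub>M\<^esub>\<close> is the zero element;
  tensors are written \<open>pure_tensor\<close>. A bimodule record extends a right module record, so every
  bimodule can be used as a right module.
\<close>

record ('a, 'm) right_module = "'m monoid" +
  ract :: "'m \<Rightarrow> 'a \<Rightarrow> 'm"

record ('a, 'm) bimodule = "('a, 'm) right_module" +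
  lact :: "'a \<Rightarrow> 'm \<Rightarrow> 'm"

definition is_right_module ::
  "('a, 'z) ring_scheme \<Rightarrow> ('a, 'm, 'y) right_module_scheme \<Rightarrow> bool" where
  "is_right_module A M \<longleftrightarrow>
     comm_group M \<and>
     (\<forall>a\<in>carrier A. (\<lambda>m. ract M m a) \<in> hom M M) \<and>
     (\<forall>m\<in>carrier M. (\<lambda>a. ract M m a) \<in> hom (add_monoid A) M) \<and>
     (\<forall>m\<in>carrier M. \<forall>a\<in>carrier A. \<forall>b\<in>carrier A.
        ract M m (a \<otimes>\<^bsub>A\<^esub> b) = ract M (ract M m a) b) \<and>
     (\<forall>m\<in>carrier M. ract M m \<one>\<^bsub>A\<^esub> = m)"

definition is_bimodule ::
  "('a, 'z) ring_scheme \<Rightarrow> ('a, 'm, 'y) bimodule_scheme \<Rightarrow> bool" where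
  "is_bimodule A M \<longleftrightarrow>
     is_right_module A M \<and>
     (\<forall>a\<in>carrier A. (\<lambda>m. lact M a m) \<in> hom M M) \<and>
     (\<forall>m\<in>carrier M. (\<lambda>a. lact M a m) \<in> hom (add_monoid A) M) \<and>
     (\<forall>m\<in>carrier M. \<forall>a\<in>carrier A. \<forall>b\<in>carrier A.
        lact M (a \<otimes>\<^bsub>A\<^esub> b) m = lact M a (lact M b m)) \<and>
     (\<forall>m\<in>carrier M. lact M \<one>\<^bsub>A\<^esub> m = m) \<and>
     (\<forall>m\<in>carrier M. \<forall>a\<in>carrier A. \<forall>b\<in>carrier A.
        ract M (lact M a m) b = lact M a (ract M m b))"

definition right_linear_maps ::
  "('a, 'z) ring_scheme \<Rightarrow> ('a, 'm, 'x) right_module_scheme \<Rightarrow> ('a, 'n, 'y) right_module_scheme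
    \<Rightarrow> ('m \<Rightarrow> 'n) set" where
  "right_linear_maps A M N =
     {f \<in> hom M N. \<forall>m\<in>carrier M. \<forall>a\<in>carrier A. f (ract M m a) = ract N (f m) a}"

definition bimodule_maps ::
  "('a, 'z) ring_scheme \<Rightarrow> ('a, 'm, 'x) bimodule_scheme \<Rightarrow> ('a, 'n, 'y) bimodule_scheme
    \<Rightarrow> ('m \<Rightarrow> 'n) set" where
  "bimodule_maps A M N =
     {f \<in> right_linear_maps A M N.
        \<forall>m\<in>carrier M. \<forall>a\<in>carrier A. f (lact M a m) = lact N a (f m)}"

definition bimodule_isos ::
  "('a, 'z) ring_scheme \<Rightarrow> ('a, 'm, 'x) bimodule_scheme \<Rightarrow> ('a, 'n, 'y) bimodule_scheme
    \<Rightarrow> ('m \<Rightarrow> 'n) set" where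
  "bimodule_isos A M N = {f \<in> bimodule_maps A M N. bij_betw f (carrier M) (carrier N)}"

definition regular_bimodule :: "('a, 'z) ring_scheme \<Rightarrow> ('a, 'a) bimodule" where
  "regular_bimodule A =
     \<lparr>carrier = carrier A, monoid.mult = add A, one = \<zero>\<^bsub>A\<^esub>,
      ract = monoid.mult A, lact = monoid.mult A\<rparr>"


section \<open>Tensor products over \<open>A\<close>\<close>

text \<open>
  \<open>M \<otimes>\<^sub>A N\<close> is the free abelian group on \<open>carrier M \<times> carrier N\<close> modulo the subgroup
  generated by the usual relations; its elements are cosets.
\<close>

type_synonym ('m, 'n) tensor = "('m \<times> 'n \<Rightarrow>\<^sub>0 int) set"

definition tensor_relations ::
  "('a, 'z) ring_scheme \<Rightarrow> ('a, 'm, 'x) right_module_scheme \<Rightarrow> ('a, 'n, 'y) bimodule_scheme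
    \<Rightarrow> ('m, 'n) tensor" where
  "tensor_relations A M N =
     {frag_of (m \<otimes>\<^bsub>M\<^esub> m', n) - (frag_of (m, n) + frag_of (m', n)) | m m' n.
        m \<in> carrier M \<and> m' \<in> carrier M \<and> n \<in> carrier N} \<union>
     {frag_of (m, n \<otimes>\<^bsub>N\<^esub> n') - (frag_of (m, n) + frag_of (m, n')) | m n n'.
        m \<in> carrier M \<and> n \<in> carrier N \<and> n' \<in> carrier N} \<union>
     {frag_of (ract M m a, n) - frag_of (m, lact N a n) | m a n.
        m \<in> carrier M \<and> a \<in> carrier A \<and> n \<in> carrier N}"

definition tensor_kernel ::
  "('a, 'z) ring_scheme \<Rightarrow> ('a, 'm, 'x) right_module_scheme \<Rightarrow> ('a, 'n, 'y) bimodule_scheme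
    \<Rightarrow> ('m, 'n) tensor" where
  "tensor_kernel A M N =
     generate (free_Abelian_group (carrier M \<times> carrier N)) (tensor_relations A M N)"

definition tensor_group ::
  "('a, 'z) ring_scheme \<Rightarrow> ('a, 'm, 'x) right_module_scheme \<Rightarrow> ('a, 'n, 'y) bimodule_scheme
    \<Rightarrow> ('m, 'n) tensor monoid" where
  "tensor_group A M N =
     free_Abelian_group (carrier M \<times> carrier N) Mod tensor_kernel A M N"

definition pure_tensor ::
  "('a, 'z) ring_scheme \<Rightarrow> ('a, 'm, 'x) right_module_scheme \<Rightarrow> ('a, 'n, 'y) bimodule_scheme
    \<Rightarrow> 'm \<Rightarrow> 'n \<Rightarrow> ('m, 'n) tensor" where
  "pure_tensor A M N m n =
     tensor_kernel A M N #>\<^bsub>free_Abelian_group (carrier M \<times> carrier N)\<^esub> frag_of (m, n)"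

text \<open>
  The additive map \<open>M \<otimes>\<^sub>A N \<rightarrow> X\<close> induced by \<open>f\<close>. It exists and is unique whenever \<open>f\<close> is
  biadditive and \<open>A\<close>-balanced (\<open>tensor_lift_ex1\<close>), which is the case in all uses below.
\<close>

definition tensor_lift ::
  "('a, 'z) ring_scheme \<Rightarrow> ('a, 'm, 'x) right_module_scheme \<Rightarrow> ('a, 'n, 'y) bimodule_scheme
    \<Rightarrow> ('t, 'w) monoid_scheme \<Rightarrow> ('m \<Rightarrow> 'n \<Rightarrow> 't) \<Rightarrow> ('m, 'n) tensor \<Rightarrow> 't" where
  "tensor_lift A M N X f =
     (THE h. h \<in> hom (tensor_group A M N) X \<and> h \<in> extensional (carrier (tensor_group A M N)) \<and>
             (\<forall>m\<in>carrier M. \<forall>n\<in>carrier N. h (pure_tensor A M N m n) = f m n))"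

lemma tensor_lift_ex1:
  fixes M :: "('a, 'm, 'x) right_module_scheme" and N :: "('a, 'n, 'y) bimodule_scheme"
  assumes M: "is_right_module A M" and N: "is_bimodule A N" and X: "comm_group X"
    and cl: "\<And>m n. m \<in> carrier M \<Longrightarrow> n \<in> carrier N \<Longrightarrow> f m n \<in> carrier X"
    and a1: "\<And>m m' n. \<lbrakk>m \<in> carrier M; m' \<in> carrier M; n \<in> carrier N\<rbrakk> \<Longrightarrow> f (m \<otimes>\<^bsub>M\<^esub> m') n = f m n \<otimes>\<^bsub>X\<^esub> f m' n"
    and a2: "\<And>m n n'. \<lbrakk>m \<in> carrier M; n \<in> carrier N; n' \<in> carrier N\<rbrakk> \<Longrightarrow> f m (n \<otimes>\<^bsub>N\<^esub> n') = f m n \<otimes>\<^bsub>X\<^esub> f m n'"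
    and a3: "\<And>m a n. \<lbrakk>m \<in> carrier M; a \<in> carrier A; n \<in> carrier N\<rbrakk> \<Longrightarrow> f (ract M m a) n = f m (lact N a n)"
  shows "\<exists>!h. h \<in> hom (tensor_group A M N) X \<and> h \<in> extensional (carrier (tensor_group A M N)) \<and>
             (\<forall>m\<in>carrier M. \<forall>n\<in>carrier N. h (pure_tensor A M N m n) = f m n)"
proof -
  interpret M: comm_group M using M by (simp add: is_right_module_def)
  interpret N: comm_group N using N by (simp add: is_right_module_def is_bimodule_def)
  interpret X: comm_group X by fact
  define S where "S = carrier M \<times> carrier N"
  define F where "F = free_Abelian_group S"
  define K where "K = tensor_kernel A M N"
  interpret F: comm_group F unfolding F_def by (rule abelian_free_Abelian_group)
  have rc: "ract M m a \<in> carrier M" if "m \<in> carrier M" "a \<in> carrier A" for m a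
    using M that by (auto simp: is_right_module_def hom_def)
  have lc: "lact N a n \<in> carrier N" if "n \<in> carrier N" "a \<in> carrier A" for n a
    using N that by (auto simp: is_bimodule_def hom_def)
  have cF: "x \<in> carrier F \<longleftrightarrow> Poly_Mapping.keys x \<subseteq> S" for x by (simp add: F_def)
  have fF: "frag_of (m,n) \<in> carrier F" if "m \<in> carrier M" "n \<in> carrier N" for m n
    using that unfolding F_def S_def by simp
  have pF: "x + y \<in> carrier F" if "x \<in> carrier F" "y \<in> carrier F" for x y
    using F.m_closed[OF that] by (simp add: F_def)
  have mF: "x - y = x \<otimes>\<^bsub>F\<^esub> inv\<^bsub>F\<^esub> y" if "y \<in> carrier F" for x y
    using that by (simp add: F_def)
  have dF: "x - y \<in> carrier F" if "x \<in> carrier F" "y \<in> carrier F" for x y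
    using that mF by simp
  have rel: "tensor_relations A M N \<subseteq> carrier F"
    unfolding tensor_relations_def by (auto intro!: dF pF fF rc lc)
  have K: "subgroup K F" unfolding K_def tensor_kernel_def F_def[symmetric] S_def[symmetric]
    using rel by (rule F.generate_is_subgroup)
  interpret K: normal K F using K by (rule F.subgroup_imp_normal)
  have fS: "(\<lambda>(m,n). f m n) ` S \<subseteq> carrier X" using cl by (auto simp: S_def)
  obtain h0 where h0: "h0 \<in> hom F X" "\<And>x. x \<in> S \<Longrightarrow> h0 (frag_of x) = (\<lambda>(m,n). f m n) x"
    using X.free_Abelian_group_universal[OF fS] unfolding F_def by metis
  interpret h0: group_hom F X h0 by unfold_locales (rule h0)
  have h0f: "h0 (frag_of (m,n)) = f m n" if "m \<in> carrier M" "n \<in> carrier N" for m n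
    using h0(2)[of "(m,n)"] that by (simp add: S_def)
  have h0p: "h0 (x+y) = h0 x \<otimes>\<^bsub>X\<^esub> h0 y" if "x \<in> carrier F" "y \<in> carrier F" for x y
    using h0.hom_mult[OF that] by (simp add: F_def)
  have h0d: "h0 (x-y) = h0 x \<otimes>\<^bsub>X\<^esub> inv\<^bsub>X\<^esub> h0 y" if "x \<in> carrier F" "y \<in> carrier F" for x y
    using that mF by simp
  have relk: "tensor_relations A M N \<subseteq> kernel F X h0"
    unfolding tensor_relations_def kernel_def
    by (auto intro!: dF pF fF rc lc simp: h0d h0p h0f fF pF a1 a2 a3 rc lc cl)
  have Kk: "K \<subseteq> kernel F X h0" unfolding K_def tensor_kernel_def F_def[symmetric] S_def[symmetric]
    using relk h0.subgroup_kernel by (rule F.generate_subgroup_incl)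
  have T: "tensor_group A M N = F Mod K" by (simp add: tensor_group_def F_def K_def S_def)
  have P: "pure_tensor A M N m n = K #>\<^bsub>F\<^esub> frag_of (m,n)" for m n
    by (simp add: pure_tensor_def F_def K_def S_def)
  obtain g where g: "g \<in> hom (F Mod K) X" "\<And>x. x \<in> carrier F \<Longrightarrow> g (K #>\<^bsub>F\<^esub> x) = h0 x"
    by (rule h0.FactGroup_universal_kernel[OF K.normal_axioms Kk]) blast
  show ?thesis
  proof (rule ex1I)
    let ?g = "restrict g (carrier (F Mod K))"
    interpret FK: group "F Mod K" by (rule K.factorgroup_is_group)
    show "?g \<in> hom (tensor_group A M N) X \<and> ?g \<in> extensional (carrier (tensor_group A M N)) \<and>
             (\<forall>m\<in>carrier M. \<forall>n\<in>carrier N. ?g (pure_tensor A M N m n) = f m n)"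
      unfolding T P using g fF h0f
      by (auto simp: hom_def Pi_def carrier_FactGroup K.rcos_sum)
  next
    fix h assume h: "h \<in> hom (tensor_group A M N) X \<and> h \<in> extensional (carrier (tensor_group A M N)) \<and>
             (\<forall>m\<in>carrier M. \<forall>n\<in>carrier N. h (pure_tensor A M N m n) = f m n)"
    have hh: "h \<in> hom (F Mod K) X" and hp: "\<And>m n. \<lbrakk>m \<in> carrier M; n \<in> carrier N\<rbrakk> \<Longrightarrow> h (K #>\<^bsub>F\<^esub> frag_of (m,n)) = f m n"
      using h by (auto simp: T P)
    interpret FK: group "F Mod K" by (rule K.factorgroup_is_group)
    interpret c: group_hom F X "\<lambda>x. h (K #>\<^bsub>F\<^esub> x)"
      by unfold_locales (use hom_compose[OF K.r_coset_hom_Mod hh] in \<open>simp add: comp_def\<close>)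
    have "Poly_Mapping.keys x \<subseteq> S \<Longrightarrow> h (K #>\<^bsub>F\<^esub> x) = h0 x" for x
    proof (induction rule: free_Abelian_group_induct[consumes 1, case_names 1 2 3])
      case 1 then show ?case using c.hom_one h0.hom_one by (simp add: F_def)
    next
      case (2 x y)
      then have "x \<in> carrier F" "y \<in> carrier F" by (auto simp: F_def)
      then show ?case using 2 mF[of y x] by simp
    next
      case (3 a) then show ?case using hp h0f by (auto simp: S_def)
    qed
    then have "h (K #>\<^bsub>F\<^esub> x) = g (K #>\<^bsub>F\<^esub> x)" if "x \<in> carrier F" for x
      using g(2) that cF by simp
    then show "h = restrict g (carrier (F Mod K))"
      using h unfolding T by (intro extensionalityI[of _ "carrier (F Mod K)"]) (auto simp: carrier_FactGroup)
  qed
qed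

definition right_tensor ::
  "('a, 'z) ring_scheme \<Rightarrow> ('a, 'm, 'x) right_module_scheme \<Rightarrow> ('a, 'n, 'y) bimodule_scheme
    \<Rightarrow> ('a, ('m, 'n) tensor) right_module" where
  "right_tensor A M N =
     \<lparr>carrier = carrier (tensor_group A M N),
      monoid.mult = monoid.mult (tensor_group A M N),
      one = one (tensor_group A M N),
      ract = (\<lambda>t a. tensor_lift A M N (tensor_group A M N)
                      (\<lambda>m n. pure_tensor A M N m (ract N n a)) t)\<rparr>"

definition bimodule_tensor ::
  "('a, 'z) ring_scheme \<Rightarrow> ('a, 'm, 'x) bimodule_scheme \<Rightarrow> ('a, 'n, 'y) bimodule_scheme
    \<Rightarrow> ('a, ('m, 'n) tensor) bimodule" where
  "bimodule_tensor A M N =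
     \<lparr>carrier = carrier (tensor_group A M N),
      monoid.mult = monoid.mult (tensor_group A M N),
      one = one (tensor_group A M N),
      ract = ract (right_tensor A M N),
      lact = (\<lambda>a t. tensor_lift A M N (tensor_group A M N)
                      (\<lambda>m n. pure_tensor A M N (lact M a m) n) t)\<rparr>"

text \<open>\<open>f \<otimes>\<^sub>A g : M \<otimes>\<^sub>A N \<rightarrow> M' \<otimes>\<^sub>A N'\<close>\<close>

definition tensor_map ::
  "('a, 'z) ring_scheme
    \<Rightarrow> ('a, 'm, 'x) right_module_scheme \<Rightarrow> ('a, 'n, 'y) bimodule_scheme
    \<Rightarrow> ('a, 'p, 'u) right_module_scheme \<Rightarrow> ('a, 'q, 'v) bimodule_scheme
    \<Rightarrow> ('m \<Rightarrow> 'p) \<Rightarrow> ('n \<Rightarrow> 'q) \<Rightarrow> ('m, 'n) tensor \<Rightarrow> ('p, 'q) tensor" where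
  "tensor_map A M N M' N' f g =
     tensor_lift A M N (tensor_group A M' N') (\<lambda>m n. pure_tensor A M' N' (f m) (g n))"

text \<open>
  The canonical isomorphisms \<open>(M \<otimes>\<^sub>A N) \<otimes>\<^sub>A P \<rightarrow> M \<otimes>\<^sub>A (N \<otimes>\<^sub>A P)\<close>,
  \<open>M \<otimes>\<^sub>A A \<rightarrow> M\<close> and \<open>A \<otimes>\<^sub>A M \<rightarrow> M\<close>, which are usually suppressed in the notation.
\<close>

definition associator ::
  "('a, 'z) ring_scheme \<Rightarrow> ('a, 'm, 'x) right_module_scheme \<Rightarrow> ('a, 'n, 'y) bimodule_scheme
    \<Rightarrow> ('a, 'p, 'u) bimodule_scheme
    \<Rightarrow> (('m, 'n) tensor, 'p) tensor \<Rightarrow> ('m, ('n, 'p) tensor) tensor" where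
  "associator A M N P =
     (let X = tensor_group A M (bimodule_tensor A N P) in
      tensor_lift A (right_tensor A M N) P X
        (\<lambda>t p. tensor_lift A M N X
           (\<lambda>m n. pure_tensor A M (bimodule_tensor A N P) m (pure_tensor A N P n p)) t))"

definition right_unitor ::
  "('a, 'z) ring_scheme \<Rightarrow> ('a, 'm, 'x) right_module_scheme \<Rightarrow> ('m, 'a) tensor \<Rightarrow> 'm" where
  "right_unitor A M = tensor_lift A M (regular_bimodule A) M (\<lambda>m a. ract M m a)"

definition left_unitor ::
  "('a, 'z) ring_scheme \<Rightarrow> ('a, 'm, 'x) bimodule_scheme \<Rightarrow> ('a, 'm) tensor \<Rightarrow> 'm" where
  "left_unitor A M = tensor_lift A (regular_bimodule A) M M (\<lambda>a m. lact M a m)"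


section \<open>Corings and group corings\<close>

record ('a, 'c) coring =
  cobase :: "('a, 'c) bimodule"
  comult :: "'c \<Rightarrow> ('c, 'c) tensor"
  counit :: "'c \<Rightarrow> 'a"

definition is_coring :: "('a, 'z) ring_scheme \<Rightarrow> ('a, 'c) coring \<Rightarrow> bool" where
  "is_coring A D \<longleftrightarrow>
     (let B = cobase D; R = regular_bimodule A in
      is_bimodule A B \<and>
      comult D \<in> bimodule_maps A B (bimodule_tensor A B B) \<and>
      counit D \<in> bimodule_maps A B R \<and>
      (\<forall>c\<in>carrier B.
         associator A B B B
           (tensor_map A B B (bimodule_tensor A B B) B (comult D) id (comult D c)) =
         tensor_map A B B B (bimodule_tensor A B B) id (comult D) (comult D c)) \<and>
      (\<forall>c\<in>carrier B.
         right_unitor A B (tensor_map A B B B R id (counit D) (comult D c)) = c \<and>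
         left_unitor A B (tensor_map A B B R B (counit D) id (comult D c)) = c))"

record ('g, 'a, 'c) group_coring =
  gcobase :: "'g \<Rightarrow> ('a, 'c) bimodule"
  gcomult :: "'g \<Rightarrow> 'g \<Rightarrow> 'c \<Rightarrow> ('c, 'c) tensor"
  gcounit :: "'c \<Rightarrow> 'a"

definition is_group_coring ::
  "('g, 'w) monoid_scheme \<Rightarrow> ('a, 'z) ring_scheme \<Rightarrow> ('g, 'a, 'c) group_coring \<Rightarrow> bool" where
  "is_group_coring G A C \<longleftrightarrow>
     (let B = gcobase C; \<Delta> = gcomult C; \<epsilon> = gcounit C; e = \<one>\<^bsub>G\<^esub>; R = regular_bimodule A in
      (\<forall>\<alpha>\<in>carrier G. is_bimodule A (B \<alpha>)) \<and>
      (\<forall>\<alpha>\<in>carrier G. \<forall>\<beta>\<in>carrier G.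
         \<Delta> \<alpha> \<beta> \<in> bimodule_maps A (B (\<alpha> \<otimes>\<^bsub>G\<^esub> \<beta>)) (bimodule_tensor A (B \<alpha>) (B \<beta>))) \<and>
      \<epsilon> \<in> bimodule_maps A (B e) R \<and>
      (\<forall>\<alpha>\<in>carrier G. \<forall>\<beta>\<in>carrier G. \<forall>\<gamma>\<in>carrier G.
         \<forall>c\<in>carrier (B (\<alpha> \<otimes>\<^bsub>G\<^esub> \<beta> \<otimes>\<^bsub>G\<^esub> \<gamma>)).
         associator A (B \<alpha>) (B \<beta>) (B \<gamma>)
           (tensor_map A (B (\<alpha> \<otimes>\<^bsub>G\<^esub> \<beta>)) (B \<gamma>) (bimodule_tensor A (B \<alpha>) (B \<beta>)) (B \<gamma>)
              (\<Delta> \<alpha> \<beta>) id (\<Delta> (\<alpha> \<otimes>\<^bsub>G\<^esub> \<beta>) \<gamma> c)) =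
         tensor_map A (B \<alpha>) (B (\<beta> \<otimes>\<^bsub>G\<^esub> \<gamma>)) (B \<alpha>) (bimodule_tensor A (B \<beta>) (B \<gamma>))
           id (\<Delta> \<beta> \<gamma>) (\<Delta> \<alpha> (\<beta> \<otimes>\<^bsub>G\<^esub> \<gamma>) c)) \<and>
      (\<forall>\<alpha>\<in>carrier G. \<forall>c\<in>carrier (B \<alpha>).
         right_unitor A (B \<alpha>) (tensor_map A (B \<alpha>) (B e) (B \<alpha>) R id \<epsilon> (\<Delta> \<alpha> e c)) = c \<and>
         left_unitor A (B \<alpha>) (tensor_map A (B e) (B \<alpha>) R (B \<alpha>) \<epsilon> id (\<Delta> e \<alpha> c)) = c))"

definition unit_coring ::
  "('g, 'w) monoid_scheme \<Rightarrow> ('g, 'a, 'c) group_coring \<Rightarrow> ('a, 'c) coring" where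
  "unit_coring G C =
     \<lparr>cobase = gcobase C \<one>\<^bsub>G\<^esub>, comult = gcomult C \<one>\<^bsub>G\<^esub> \<one>\<^bsub>G\<^esub>, counit = gcounit C\<rparr>"

lemma is_coring_unit_coring:
  assumes "group G" "is_group_coring G A C"
  shows "is_coring A (unit_coring G C)"
proof -
  interpret group G by fact
  show ?thesis
    using assms(2) one_closed
    unfolding is_coring_def is_group_coring_def unit_coring_def Let_def
    by (auto dest!: bspec[where x = "\<one>\<^bsub>G\<^esub>"])
qed

definition cofree ::
  "('g, 'w) monoid_scheme \<Rightarrow> ('a, 'z) ring_scheme \<Rightarrow> ('g, 'a, 'c) group_coring \<Rightarrow> bool" where
  "cofree G A C \<longleftrightarrow>
     (let B = gcobase C; \<Delta> = gcomult C; e = \<one>\<^bsub>G\<^esub> in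
      \<exists>\<gamma>. (\<forall>\<alpha>\<in>carrier G. \<gamma> \<alpha> \<in> bimodule_isos A (B e) (B \<alpha>)) \<and>
          (\<forall>\<alpha>\<in>carrier G. \<forall>\<beta>\<in>carrier G. \<forall>c\<in>carrier (B e).
             \<Delta> \<alpha> \<beta> (\<gamma> (\<alpha> \<otimes>\<^bsub>G\<^esub> \<beta>) c) =
             tensor_map A (B e) (B e) (B \<alpha>) (B \<beta>) (\<gamma> \<alpha>) (\<gamma> \<beta>) (\<Delta> e e c)))"


section \<open>Categories and equivalences\<close>

text \<open>
  Hom-sets are indexed by pairs of objects and need not be disjoint; \<open>Comp X Y Z g f\<close> is the
  composite of \<open>f : X \<rightarrow> Y\<close> and \<open>g : Y \<rightarrow> Z\<close>.
\<close>

record ('o, 'h) category =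
  Obj :: "'o set"
  Hom :: "'o \<Rightarrow> 'o \<Rightarrow> 'h set"
  Ident :: "'o \<Rightarrow> 'h"
  Comp :: "'o \<Rightarrow> 'o \<Rightarrow> 'o \<Rightarrow> 'h \<Rightarrow> 'h \<Rightarrow> 'h"

definition is_category :: "('o, 'h) category \<Rightarrow> bool" where
  "is_category \<C> \<longleftrightarrow>
     (\<forall>X\<in>Obj \<C>. Ident \<C> X \<in> Hom \<C> X X) \<and>
     (\<forall>X\<in>Obj \<C>. \<forall>Y\<in>Obj \<C>. \<forall>Z\<in>Obj \<C>. \<forall>f\<in>Hom \<C> X Y. \<forall>g\<in>Hom \<C> Y Z.
        Comp \<C> X Y Z g f \<in> Hom \<C> X Z) \<and>
     (\<forall>X\<in>Obj \<C>. \<forall>Y\<in>Obj \<C>. \<forall>f\<in>Hom \<C> X Y.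
        Comp \<C> X X Y f (Ident \<C> X) = f \<and> Comp \<C> X Y Y (Ident \<C> Y) f = f) \<and>
     (\<forall>W\<in>Obj \<C>. \<forall>X\<in>Obj \<C>. \<forall>Y\<in>Obj \<C>. \<forall>Z\<in>Obj \<C>.
        \<forall>f\<in>Hom \<C> W X. \<forall>g\<in>Hom \<C> X Y. \<forall>h\<in>Hom \<C> Y Z.
        Comp \<C> W Y Z h (Comp \<C> W X Y g f) = Comp \<C> W X Z (Comp \<C> X Y Z h g) f)"

record ('o, 'h, 'p, 'k) cat_functor =
  fobj :: "'o \<Rightarrow> 'p"
  farr :: "'o \<Rightarrow> 'o \<Rightarrow> 'h \<Rightarrow> 'k"

definition is_functor ::
  "('o, 'h) category \<Rightarrow> ('p, 'k) category \<Rightarrow> ('o, 'h, 'p, 'k) cat_functor \<Rightarrow> bool" where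
  "is_functor \<C> \<D> F \<longleftrightarrow>
     (\<forall>X\<in>Obj \<C>. fobj F X \<in> Obj \<D>) \<and>
     (\<forall>X\<in>Obj \<C>. \<forall>Y\<in>Obj \<C>. \<forall>f\<in>Hom \<C> X Y. farr F X Y f \<in> Hom \<D> (fobj F X) (fobj F Y)) \<and>
     (\<forall>X\<in>Obj \<C>. farr F X X (Ident \<C> X) = Ident \<D> (fobj F X)) \<and>
     (\<forall>X\<in>Obj \<C>. \<forall>Y\<in>Obj \<C>. \<forall>Z\<in>Obj \<C>. \<forall>f\<in>Hom \<C> X Y. \<forall>g\<in>Hom \<C> Y Z.
        farr F X Z (Comp \<C> X Y Z g f) =
        Comp \<D> (fobj F X) (fobj F Y) (fobj F Z) (farr F Y Z g) (farr F X Y f))"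

definition id_functor :: "('o, 'h, 'o, 'h) cat_functor" where
  "id_functor = \<lparr>fobj = (\<lambda>X. X), farr = (\<lambda>X Y f. f)\<rparr>"

definition comp_functor ::
  "('p, 'k, 'q, 'l) cat_functor \<Rightarrow> ('o, 'h, 'p, 'k) cat_functor \<Rightarrow> ('o, 'h, 'q, 'l) cat_functor"
  where
  "comp_functor F' F =
     \<lparr>fobj = (\<lambda>X. fobj F' (fobj F X)),
      farr = (\<lambda>X Y f. farr F' (fobj F X) (fobj F Y) (farr F X Y f))\<rparr>"

definition is_iso_arrow :: "('o, 'h) category \<Rightarrow> 'o \<Rightarrow> 'o \<Rightarrow> 'h \<Rightarrow> bool" where
  "is_iso_arrow \<C> X Y f \<longleftrightarrow>
     f \<in> Hom \<C> X Y \<and>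
     (\<exists>g\<in>Hom \<C> Y X. Comp \<C> X Y X g f = Ident \<C> X \<and> Comp \<C> Y X Y f g = Ident \<C> Y)"

definition is_natural_iso ::
  "('o, 'h) category \<Rightarrow> ('p, 'k) category
    \<Rightarrow> ('o, 'h, 'p, 'k) cat_functor \<Rightarrow> ('o, 'h, 'p, 'k) cat_functor \<Rightarrow> ('o \<Rightarrow> 'k) \<Rightarrow> bool" where
  "is_natural_iso \<C> \<D> F F' \<eta> \<longleftrightarrow>
     (\<forall>X\<in>Obj \<C>. is_iso_arrow \<D> (fobj F X) (fobj F' X) (\<eta> X)) \<and>
     (\<forall>X\<in>Obj \<C>. \<forall>Y\<in>Obj \<C>. \<forall>f\<in>Hom \<C> X Y.
        Comp \<D> (fobj F X) (fobj F Y) (fobj F' Y) (\<eta> Y) (farr F X Y f) =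
        Comp \<D> (fobj F X) (fobj F' X) (fobj F' Y) (farr F' X Y f) (\<eta> X))"

definition equivalent_categories ::
  "('o, 'h) category \<Rightarrow> ('p, 'k) category \<Rightarrow> bool" where
  "equivalent_categories \<C> \<D> \<longleftrightarrow>
     is_category \<C> \<and> is_category \<D> \<and>
     (\<exists>F F' \<eta> \<theta>. is_functor \<C> \<D> F \<and> is_functor \<D> \<C> F' \<and>
        is_natural_iso \<C> \<C> id_functor (comp_functor F' F) \<eta> \<and>
        is_natural_iso \<D> \<D> (comp_functor F F') id_functor \<theta>)"


section \<open>Categories of comodules\<close>

text \<open>
  The underlying modules have their elements in a type \<open>'m\<close>, which plays the role of the universe.
  Morphisms are extensional (\<open>undefined\<close> off the relevant carriers), so that equality of morphisms
  is equality on the carriers.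
\<close>

record ('a, 'c, 'm) comodule =
  cmod :: "('a, 'm) right_module"
  coact :: "'m \<Rightarrow> ('m, 'c) tensor"

definition is_comodule ::
  "('a, 'z) ring_scheme \<Rightarrow> ('a, 'c) coring \<Rightarrow> ('a, 'c, 'm) comodule \<Rightarrow> bool" where
  "is_comodule A D M \<longleftrightarrow>
     (let B = cobase D; N = cmod M; \<rho> = coact M in
      is_right_module A N \<and>
      \<rho> \<in> right_linear_maps A N (right_tensor A N B) \<and>
      (\<forall>m\<in>carrier N.
         tensor_map A N B N (bimodule_tensor A B B) id (comult D) (\<rho> m) =
         associator A N B B (tensor_map A N B (right_tensor A N B) B \<rho> id (\<rho> m))) \<and>
      (\<forall>m\<in>carrier N.
         right_unitor A N (tensor_map A N B N (regular_bimodule A) id (counit D) (\<rho> m)) = m))"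

definition comodule_maps ::
  "('a, 'z) ring_scheme \<Rightarrow> ('a, 'c) coring \<Rightarrow> ('a, 'c, 'm) comodule \<Rightarrow> ('a, 'c, 'm) comodule
    \<Rightarrow> ('m \<Rightarrow> 'm) set" where
  "comodule_maps A D M N =
     {f \<in> right_linear_maps A (cmod M) (cmod N) \<inter> extensional (carrier (cmod M)).
        \<forall>m\<in>carrier (cmod M).
          tensor_map A (cmod M) (cobase D) (cmod N) (cobase D) f id (coact M m) = coact N (f m)}"

definition comodule_category ::
  "('a, 'z) ring_scheme \<Rightarrow> ('a, 'c) coring \<Rightarrow> (('a, 'c, 'm) comodule, 'm \<Rightarrow> 'm) category" where
  "comodule_category A D =
     \<lparr>Obj = {M. is_comodule A D M},
      Hom = comodule_maps A D,
      Ident = (\<lambda>M. \<lambda>m\<in>carrier (cmod M). m),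
      Comp = (\<lambda>M N P g f. compose (carrier (cmod M)) g f)\<rparr>"

record ('g, 'a, 'c, 'm) group_comodule =
  gcmod :: "'g \<Rightarrow> ('a, 'm) right_module"
  gcoact :: "'g \<Rightarrow> 'g \<Rightarrow> 'm \<Rightarrow> ('m, 'c) tensor"

definition is_group_comodule ::
  "('g, 'w) monoid_scheme \<Rightarrow> ('a, 'z) ring_scheme \<Rightarrow> ('g, 'a, 'c) group_coring
    \<Rightarrow> ('g, 'a, 'c, 'm) group_comodule \<Rightarrow> bool" where
  "is_group_comodule G A C M \<longleftrightarrow>
     (let B = gcobase C; \<Delta> = gcomult C; e = \<one>\<^bsub>G\<^esub>; N = gcmod M; \<rho> = gcoact M in
      (\<forall>\<alpha>\<in>carrier G. is_right_module A (N \<alpha>)) \<and>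
      (\<forall>\<alpha>\<in>carrier G. \<forall>\<beta>\<in>carrier G.
         \<rho> \<alpha> \<beta> \<in> right_linear_maps A (N (\<alpha> \<otimes>\<^bsub>G\<^esub> \<beta>)) (right_tensor A (N \<alpha>) (B \<beta>))) \<and>
      (\<forall>\<alpha>\<in>carrier G. \<forall>\<beta>\<in>carrier G. \<forall>\<gamma>\<in>carrier G.
         \<forall>m\<in>carrier (N (\<alpha> \<otimes>\<^bsub>G\<^esub> \<beta> \<otimes>\<^bsub>G\<^esub> \<gamma>)).
         tensor_map A (N \<alpha>) (B (\<beta> \<otimes>\<^bsub>G\<^esub> \<gamma>)) (N \<alpha>) (bimodule_tensor A (B \<beta>) (B \<gamma>))
           id (\<Delta> \<beta> \<gamma>) (\<rho> \<alpha> (\<beta> \<otimes>\<^bsub>G\<^esub> \<gamma>) m) =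
         associator A (N \<alpha>) (B \<beta>) (B \<gamma>)
           (tensor_map A (N (\<alpha> \<otimes>\<^bsub>G\<^esub> \<beta>)) (B \<gamma>) (right_tensor A (N \<alpha>) (B \<beta>)) (B \<gamma>)
              (\<rho> \<alpha> \<beta>) id (\<rho> (\<alpha> \<otimes>\<^bsub>G\<^esub> \<beta>) \<gamma> m))) \<and>
      (\<forall>\<alpha>\<in>carrier G. \<forall>m\<in>carrier (N \<alpha>).
         right_unitor A (N \<alpha>)
           (tensor_map A (N \<alpha>) (B e) (N \<alpha>) (regular_bimodule A) id (gcounit C) (\<rho> \<alpha> e m)) = m))"

definition group_comodule_maps ::
  "('g, 'w) monoid_scheme \<Rightarrow> ('a, 'z) ring_scheme \<Rightarrow> ('g, 'a, 'c) group_coring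
    \<Rightarrow> ('g, 'a, 'c, 'm) group_comodule \<Rightarrow> ('g, 'a, 'c, 'm) group_comodule
    \<Rightarrow> ('g \<Rightarrow> 'm \<Rightarrow> 'm) set" where
  "group_comodule_maps G A C M N =
     {f \<in> (\<Pi>\<^sub>E \<alpha>\<in>carrier G.
              right_linear_maps A (gcmod M \<alpha>) (gcmod N \<alpha>) \<inter> extensional (carrier (gcmod M \<alpha>))).
        \<forall>\<alpha>\<in>carrier G. \<forall>\<beta>\<in>carrier G. \<forall>m\<in>carrier (gcmod M (\<alpha> \<otimes>\<^bsub>G\<^esub> \<beta>)).
          tensor_map A (gcmod M \<alpha>) (gcobase C \<beta>) (gcmod N \<alpha>) (gcobase C \<beta>)
            (f \<alpha>) id (gcoact M \<alpha> \<beta> m) =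
          gcoact N \<alpha> \<beta> (f (\<alpha> \<otimes>\<^bsub>G\<^esub> \<beta>) m)}"

definition group_comodule_category ::
  "('g, 'w) monoid_scheme \<Rightarrow> ('a, 'z) ring_scheme \<Rightarrow> ('g, 'a, 'c) group_coring
    \<Rightarrow> (('g, 'a, 'c, 'm) group_comodule, 'g \<Rightarrow> 'm \<Rightarrow> 'm) category" where
  "group_comodule_category G A C =
     \<lparr>Obj = {M. is_group_comodule G A C M},
      Hom = group_comodule_maps G A C,
      Ident = (\<lambda>M. \<lambda>\<alpha>\<in>carrier G. \<lambda>m\<in>carrier (gcmod M \<alpha>). m),
      Comp = (\<lambda>M N P g f. \<lambda>\<alpha>\<in>carrier G. compose (carrier (gcmod M \<alpha>)) (g \<alpha>) (f \<alpha>))\<rparr>"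

end

theory Submission
  imports Defs
begin

text \<open>
  Write \<open>e\<close> for the unit of \<open>G\<close>, \<open>B \<alpha>\<close> for the component of the group coring at \<open>\<alpha>\<close>, and
  \<open>\<phi> \<alpha> : B e \<rightarrow> B \<alpha>\<close> for the isomorphisms of a cofree structure. Replacing \<open>\<phi> \<alpha>\<close> by
  \<open>\<phi> \<alpha> \<circ> (\<phi> e)\<^sup>-\<^sup>1\<close> gives another cofree structure, whose component at \<open>e\<close> is the identity
  (\<open>cofree_normalized\<close>). With such a choice \<open>g\<close>, a comodule \<open>(M, \<rho>)\<close> over \<open>B e\<close> spreads to the constant
  family \<open>M\<close> with coactions \<open>(M \<otimes> g \<beta>) \<circ> \<rho>\<close>, and a group comodule restricts to its component at
  \<open>e\<close>. Spreading and restricting again changes no value on the carrier, as \<open>g e\<close> is the identity.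

  The content is that every group comodule \<open>(N, \<rho>)\<close> is constant up to isomorphism. The
  isomorphisms \<open>g \<alpha>\<close> move the counit \<open>\<epsilon>\<close> to a map \<open>\<epsilon> \<alpha> : B \<alpha> \<rightarrow> A\<close> on each component, and contracting
  the coaction with it gives a transport map
  \<open>t \<alpha> \<beta> = (N \<alpha> \<otimes> \<epsilon> \<beta>) \<circ> \<rho> \<alpha> \<beta> : N (\<alpha> \<beta>) \<rightarrow> N \<alpha>\<close>.
  Contracting one or the other coring factor in the coassociativity law of \<open>N\<close>, and using that the
  contractions of \<open>\<Delta> \<beta> \<gamma>\<close> are the identifications \<open>s\<close> of the components with one another
  (\<open>local_counit_comult\<close>), turns that law into
    \<open>(N \<alpha> \<otimes> s) \<circ> \<rho> \<alpha> (\<beta> \<gamma>) = (t \<alpha> \<beta> \<otimes> B \<gamma>) \<circ> \<rho> (\<alpha> \<beta>) \<gamma>\<close> and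
    \<open>(N \<alpha> \<otimes> s) \<circ> \<rho> \<alpha> (\<beta> \<gamma>) = \<rho> \<alpha> \<beta> \<circ> t (\<alpha> \<beta>) \<gamma>\<close>.
  Contracting the second identity once more gives \<open>t \<alpha> (\<beta> \<gamma>) = t \<alpha> \<beta> \<circ> t (\<alpha> \<beta>) \<gamma>\<close>, and \<open>t \<alpha> e\<close> is
  the identity by counitality; hence \<open>t \<alpha> \<alpha>\<^sup>-\<^sup>1 : N e \<rightarrow> N \<alpha>\<close> and \<open>t e \<alpha> : N \<alpha> \<rightarrow> N e\<close> are mutually
  inverse. The two identities also say that these maps respect the coactions, once \<open>N e\<close> is
  spread out to a constant family. They commute with morphisms since \<open>t\<close> is defined from the
  coaction alone.

  All equations between maps out of tensor products are checked on pure tensors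
  (\<open>tensor_hom_eqI\<close>, \<open>triple_tensor_hom_eqI\<close>).
\<close>

section \<open>Modules and linear maps\<close>

lemma is_right_moduleD:
  assumes "is_right_module A M"
  shows "comm_group M"
    and "\<And>m a. m \<in> carrier M \<Longrightarrow> a \<in> carrier A \<Longrightarrow> ract M m a \<in> carrier M"
    and "\<And>m m' a. m \<in> carrier M \<Longrightarrow> m' \<in> carrier M \<Longrightarrow> a \<in> carrier A \<Longrightarrow>
           ract M (m \<otimes>\<^bsub>M\<^esub> m') a = ract M m a \<otimes>\<^bsub>M\<^esub> ract M m' a"
    and "\<And>m a b. m \<in> carrier M \<Longrightarrow> a \<in> carrier A \<Longrightarrow> b \<in> carrier A \<Longrightarrow>
           ract M m (a \<oplus>\<^bsub>A\<^esub> b) = ract M m a \<otimes>\<^bsub>M\<^esub> ract M m b"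
    and "\<And>m a b. m \<in> carrier M \<Longrightarrow> a \<in> carrier A \<Longrightarrow> b \<in> carrier A \<Longrightarrow>
           ract M m (a \<otimes>\<^bsub>A\<^esub> b) = ract M (ract M m a) b"
    and "\<And>m. m \<in> carrier M \<Longrightarrow> ract M m \<one>\<^bsub>A\<^esub> = m"
    and "\<And>a. a \<in> carrier A \<Longrightarrow> (\<lambda>m. ract M m a) \<in> hom M M"
  using assms by (auto simp: is_right_module_def hom_def Pi_def)

lemma is_bimoduleD:
  assumes "is_bimodule A M"
  shows "is_right_module A M"
    and "\<And>m a. m \<in> carrier M \<Longrightarrow> a \<in> carrier A \<Longrightarrow> lact M a m \<in> carrier M"
    and "\<And>m m' a. m \<in> carrier M \<Longrightarrow> m' \<in> carrier M \<Longrightarrow> a \<in> carrier A \<Longrightarrow>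
           lact M a (m \<otimes>\<^bsub>M\<^esub> m') = lact M a m \<otimes>\<^bsub>M\<^esub> lact M a m'"
    and "\<And>m a b. m \<in> carrier M \<Longrightarrow> a \<in> carrier A \<Longrightarrow> b \<in> carrier A \<Longrightarrow>
           lact M (a \<oplus>\<^bsub>A\<^esub> b) m = lact M a m \<otimes>\<^bsub>M\<^esub> lact M b m"
    and "\<And>m a b. m \<in> carrier M \<Longrightarrow> a \<in> carrier A \<Longrightarrow> b \<in> carrier A \<Longrightarrow>
           lact M (a \<otimes>\<^bsub>A\<^esub> b) m = lact M a (lact M b m)"
    and "\<And>m. m \<in> carrier M \<Longrightarrow> lact M \<one>\<^bsub>A\<^esub> m = m"
    and "\<And>m a b. m \<in> carrier M \<Longrightarrow> a \<in> carrier A \<Longrightarrow> b \<in> carrier A \<Longrightarrow>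
           ract M (lact M a m) b = lact M a (ract M m b)"
    and "\<And>a. a \<in> carrier A \<Longrightarrow> (\<lambda>m. lact M a m) \<in> hom M M"
  using assms by (auto simp: is_bimodule_def hom_def Pi_def)

text \<open>
  In a tensor product \<open>f \<otimes> h\<close> the right factor only has to be left linear. The maps
  \<open>n \<mapsto> n a\<close>, which define the right action on \<open>M \<otimes> N\<close>, are left linear but not right linear, so
  bimodule maps would be too narrow a class here.
\<close>

definition left_linear_maps ::
  "('a, 'z) ring_scheme \<Rightarrow> ('a, 'm, 'x) bimodule_scheme \<Rightarrow> ('a, 'n, 'y) bimodule_scheme
    \<Rightarrow> ('m \<Rightarrow> 'n) set" where
  "left_linear_maps A M N =
     {f \<in> hom M N. \<forall>m\<in>carrier M. \<forall>a\<in>carrier A. f (lact M a m) = lact N a (f m)}"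

lemma right_linear_mapsD:
  assumes "f \<in> right_linear_maps A M N"
  shows "f \<in> hom M N"
    and "\<And>m. m \<in> carrier M \<Longrightarrow> f m \<in> carrier N"
    and "\<And>m m'. m \<in> carrier M \<Longrightarrow> m' \<in> carrier M \<Longrightarrow> f (m \<otimes>\<^bsub>M\<^esub> m') = f m \<otimes>\<^bsub>N\<^esub> f m'"
    and "\<And>m a. m \<in> carrier M \<Longrightarrow> a \<in> carrier A \<Longrightarrow> f (ract M m a) = ract N (f m) a"
  using assms by (auto simp: right_linear_maps_def hom_def)

lemma left_linear_mapsD:
  assumes "f \<in> left_linear_maps A M N"
  shows "f \<in> hom M N"
    and "\<And>m. m \<in> carrier M \<Longrightarrow> f m \<in> carrier N"
    and "\<And>m m'. m \<in> carrier M \<Longrightarrow> m' \<in> carrier M \<Longrightarrow> f (m \<otimes>\<^bsub>M\<^esub> m') = f m \<otimes>\<^bsub>N\<^esub> f m'"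
    and "\<And>m a. m \<in> carrier M \<Longrightarrow> a \<in> carrier A \<Longrightarrow> f (lact M a m) = lact N a (f m)"
  using assms by (auto simp: left_linear_maps_def hom_def)

lemma bimodule_maps_iff:
  "f \<in> bimodule_maps A M N \<longleftrightarrow> f \<in> right_linear_maps A M N \<and> f \<in> left_linear_maps A M N"
  by (auto simp: bimodule_maps_def left_linear_maps_def right_linear_maps_def)

lemma bimodule_mapsD:
  assumes "f \<in> bimodule_maps A M N"
  shows "f \<in> right_linear_maps A M N" and "f \<in> left_linear_maps A M N"
  using assms by (simp_all add: bimodule_maps_iff)

lemma id_linear [simp]:
  "id \<in> right_linear_maps A M M" "id \<in> left_linear_maps A N N" "id \<in> bimodule_maps A N N"
  by (auto simp: right_linear_maps_def left_linear_maps_def bimodule_maps_def hom_def)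

lemma ract_left_linear:
  assumes "is_bimodule A N" "a \<in> carrier A"
  shows "(\<lambda>n. ract N n a) \<in> left_linear_maps A N N"
  using is_right_moduleD[OF is_bimoduleD(1)[OF assms(1)]] is_bimoduleD[OF assms(1)] assms(2)
  by (auto simp: left_linear_maps_def)

lemma lact_right_linear:
  assumes "is_bimodule A M" "a \<in> carrier A"
  shows "lact M a \<in> right_linear_maps A M M"
  using is_right_moduleD[OF is_bimoduleD(1)[OF assms(1)]] is_bimoduleD[OF assms(1)] assms(2)
  by (auto simp: right_linear_maps_def)

lemma right_linear_comp:
  assumes "f \<in> right_linear_maps A M N" "g \<in> right_linear_maps A N P"
  shows "g \<circ> f \<in> right_linear_maps A M P"
  using right_linear_mapsD[OF assms(1)] right_linear_mapsD[OF assms(2)]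
  by (auto simp: right_linear_maps_def hom_def)

lemma left_linear_comp:
  assumes "f \<in> left_linear_maps A M N" "g \<in> left_linear_maps A N P"
  shows "g \<circ> f \<in> left_linear_maps A M P"
  using left_linear_mapsD[OF assms(1)] left_linear_mapsD[OF assms(2)]
  by (auto simp: left_linear_maps_def hom_def)

lemma bimodule_maps_comp:
  assumes "f \<in> bimodule_maps A M N" "g \<in> bimodule_maps A N P"
  shows "g \<circ> f \<in> bimodule_maps A M P"
  using assms by (auto simp: bimodule_maps_iff intro: right_linear_comp left_linear_comp)

lemma right_linear_cong:
  assumes "is_right_module A M" "f \<in> right_linear_maps A M N"
    and "\<And>m. m \<in> carrier M \<Longrightarrow> f m = f' m"
  shows "f' \<in> right_linear_maps A M N"
proof -
  interpret comm_group M by (rule is_right_moduleD(1)[OF assms(1)])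
  show ?thesis
    using is_right_moduleD[OF assms(1)] right_linear_mapsD[OF assms(2)]
    by (auto simp: right_linear_maps_def hom_def assms(3)[symmetric])
qed

lemma bimodule_isos_inv:
  assumes M: "is_bimodule A M" and f: "f \<in> bimodule_isos A M N"
  shows "inv_into (carrier M) f \<in> bimodule_isos A N M"
proof -
  let ?g = "inv_into (carrier M) f"
  have b: "bij_betw f (carrier M) (carrier N)" and fr: "f \<in> right_linear_maps A M N"
    and fl: "f \<in> left_linear_maps A M N"
    using f by (auto simp: bimodule_isos_def bimodule_maps_iff)
  interpret comm_group M using M by (simp add: is_bimodule_def is_right_module_def)
  note R = is_right_moduleD[OF is_bimoduleD(1)[OF M]]
  note D = is_bimoduleD[OF M] right_linear_mapsD[OF fr] left_linear_mapsD[OF fl]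
  have gb: "bij_betw ?g (carrier N) (carrier M)" by (rule bij_betw_inv_into[OF b])
  have gc: "?g n \<in> carrier M" if "n \<in> carrier N" for n using gb that by (auto simp: bij_betw_def)
  have fg: "f (?g n) = n" if "n \<in> carrier N" for n using b that by (simp add: bij_betw_inv_into_right)
  have gf: "?g (f m) = m" if "m \<in> carrier M" for m using b that by (simp add: bij_betw_inv_into_left)
  have gI: "?g n = m" if "m \<in> carrier M" "f m = n" for m n using gf that by blast
  show ?thesis
    unfolding bimodule_isos_def bimodule_maps_def right_linear_maps_def hom_def
    using gb by (auto simp: gc fg D R intro!: gI)
qed

lemma bimodule_isos_comp:
  assumes "f \<in> bimodule_isos A M N" "g \<in> bimodule_isos A N P"
  shows "g \<circ> f \<in> bimodule_isos A M P"
  using assms by (auto simp: bimodule_isos_def intro: bimodule_maps_comp bij_betw_trans)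

lemma regular_bimodule_simps [simp]:
  "carrier (regular_bimodule A) = carrier A"
  "monoid.mult (regular_bimodule A) = add A"
  "ract (regular_bimodule A) = monoid.mult A"
  "lact (regular_bimodule A) = monoid.mult A"
  by (simp_all add: regular_bimodule_def)

lemma comm_group_cong:
  assumes "comm_group G" "carrier H = carrier G" "monoid.mult H = monoid.mult G" "one H = one G"
  shows "comm_group H"
proof -
  interpret comm_group G by fact
  show ?thesis
    by (rule comm_groupI) (auto simp: assms(2-4) m_ac intro: l_inv_ex)
qed

lemma is_bimodule_regular:
  assumes "ring A"
  shows "is_bimodule A (regular_bimodule A)"
proof -
  interpret ring A by fact
  have "comm_group (regular_bimodule A)"
    by (rule comm_group_cong[OF a_comm_group]) (auto simp: regular_bimodule_def)
  then show ?thesis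
    by (auto simp: is_bimodule_def is_right_module_def hom_def l_distr r_distr m_assoc)
qed

section \<open>The universal property of the tensor product\<close>

definition balanced_maps ::
  "('a, 'z) ring_scheme \<Rightarrow> ('a, 'm, 'x) right_module_scheme \<Rightarrow> ('a, 'n, 'y) bimodule_scheme
    \<Rightarrow> ('t, 'w) monoid_scheme \<Rightarrow> ('m \<Rightarrow> 'n \<Rightarrow> 't) set" where
  "balanced_maps A M N X =
     {f. (\<forall>m\<in>carrier M. \<forall>n\<in>carrier N. f m n \<in> carrier X) \<and>
         (\<forall>m\<in>carrier M. \<forall>m'\<in>carrier M. \<forall>n\<in>carrier N. f (m \<otimes>\<^bsub>M\<^esub> m') n = f m n \<otimes>\<^bsub>X\<^esub> f m' n) \<and>
         (\<forall>m\<in>carrier M. \<forall>n\<in>carrier N. \<forall>n'\<in>carrier N. f m (n \<otimes>\<^bsub>N\<^esub> n') = f m n \<otimes>\<^bsub>X\<^esub> f m n') \<and>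
         (\<forall>m\<in>carrier M. \<forall>a\<in>carrier A. \<forall>n\<in>carrier N. f (ract M m a) n = f m (lact N a n))}"

lemma balanced_mapsI:
  assumes "\<And>m n. m \<in> carrier M \<Longrightarrow> n \<in> carrier N \<Longrightarrow> f m n \<in> carrier X"
    and "\<And>m m' n. \<lbrakk>m \<in> carrier M; m' \<in> carrier M; n \<in> carrier N\<rbrakk> \<Longrightarrow> f (m \<otimes>\<^bsub>M\<^esub> m') n = f m n \<otimes>\<^bsub>X\<^esub> f m' n"
    and "\<And>m n n'. \<lbrakk>m \<in> carrier M; n \<in> carrier N; n' \<in> carrier N\<rbrakk> \<Longrightarrow> f m (n \<otimes>\<^bsub>N\<^esub> n') = f m n \<otimes>\<^bsub>X\<^esub> f m n'"
    and "\<And>m a n. \<lbrakk>m \<in> carrier M; a \<in> carrier A; n \<in> carrier N\<rbrakk> \<Longrightarrow> f (ract M m a) n = f m (lact N a n)"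
  shows "f \<in> balanced_maps A M N X"
  using assms by (simp add: balanced_maps_def)

lemma balanced_mapsD:
  assumes "f \<in> balanced_maps A M N X"
  shows "\<And>m n. m \<in> carrier M \<Longrightarrow> n \<in> carrier N \<Longrightarrow> f m n \<in> carrier X"
    and "\<And>m m' n. \<lbrakk>m \<in> carrier M; m' \<in> carrier M; n \<in> carrier N\<rbrakk> \<Longrightarrow> f (m \<otimes>\<^bsub>M\<^esub> m') n = f m n \<otimes>\<^bsub>X\<^esub> f m' n"
    and "\<And>m n n'. \<lbrakk>m \<in> carrier M; n \<in> carrier N; n' \<in> carrier N\<rbrakk> \<Longrightarrow> f m (n \<otimes>\<^bsub>N\<^esub> n') = f m n \<otimes>\<^bsub>X\<^esub> f m n'"
    and "\<And>m a n. \<lbrakk>m \<in> carrier M; a \<in> carrier A; n \<in> carrier N\<rbrakk> \<Longrightarrow> f (ract M m a) n = f m (lact N a n)"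
  using assms by (simp_all add: balanced_maps_def)

lemma balanced_maps_linear:
  assumes "F \<in> balanced_maps A M' N' X" "f \<in> right_linear_maps A M M'" "g \<in> left_linear_maps A N N'"
  shows "(\<lambda>m n. F (f m) (g n)) \<in> balanced_maps A M N X"
  using right_linear_mapsD[OF assms(2)] left_linear_mapsD[OF assms(3)] balanced_mapsD[OF assms(1)]
  by (auto intro!: balanced_mapsI)

lemma balanced_maps_hom:
  assumes "F \<in> balanced_maps A M N X" "h \<in> hom X Y"
  shows "(\<lambda>m n. h (F m n)) \<in> balanced_maps A M N Y"
  using balanced_mapsD[OF assms(1)] hom_in_carrier[OF assms(2)] hom_mult[OF assms(2)]
  by (auto intro!: balanced_mapsI)

text \<open>
  The three families of generators of \<open>tensor_kernel\<close> are exactly the differences that must vanish for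
  \<open>pure_tensor\<close> to be balanced, so two cosets agree as soon as their representatives differ by a
  generator.
\<close>

lemma
  fixes M :: "('a, 'm, 'x) right_module_scheme" and N :: "('a, 'n, 'y) bimodule_scheme"
  assumes M: "is_right_module A M" and N: "is_bimodule A N"
  shows comm_group_tensor: "comm_group (tensor_group A M N)"
    and pure_tensor_balanced: "pure_tensor A M N \<in> balanced_maps A M N (tensor_group A M N)"
proof -
  define F where "F = free_Abelian_group (carrier M \<times> carrier N)"
  define K where "K = tensor_kernel A M N"
  interpret M: comm_group M by (rule is_right_moduleD(1)[OF M])
  interpret N: comm_group N by (rule is_right_moduleD(1)[OF is_bimoduleD(1)[OF N]])
  interpret F: comm_group F unfolding F_def by (rule abelian_free_Abelian_group)
  note rc = is_right_moduleD(2)[OF M] and lc = is_bimoduleD(2)[OF N]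
  have fF: "frag_of (m,n) \<in> carrier F" if "m \<in> carrier M" "n \<in> carrier N" for m n
    using that unfolding F_def by simp
  have aF: "x + y = x \<otimes>\<^bsub>F\<^esub> y" for x y by (simp add: F_def)
  have mF: "x - y = x \<otimes>\<^bsub>F\<^esub> inv\<^bsub>F\<^esub> y" if "y \<in> carrier F" for x y
    using that by (simp add: F_def)
  have pF: "x + y \<in> carrier F" if "x \<in> carrier F" "y \<in> carrier F" for x y
    using F.m_closed[OF that] by (simp add: F_def)
  have dF: "x - y \<in> carrier F" if "x \<in> carrier F" "y \<in> carrier F" for x y
    using that mF by simp
  have rel: "tensor_relations A M N \<subseteq> carrier F"
    unfolding tensor_relations_def by (auto intro!: dF pF fF rc lc)
  have K: "subgroup K F" unfolding K_def tensor_kernel_def F_def[symmetric]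
    using rel by (rule F.generate_is_subgroup)
  interpret K: normal K F using K by (rule F.subgroup_imp_normal)
  have relK: "x \<in> K" if "x \<in> tensor_relations A M N" for x
    unfolding K_def tensor_kernel_def using that by (rule generate.incl)
  have T: "tensor_group A M N = F Mod K" by (simp add: tensor_group_def F_def K_def)
  have P: "pure_tensor A M N m n = K #>\<^bsub>F\<^esub> frag_of (m,n)" for m n
    by (simp add: pure_tensor_def F_def K_def)
  show "comm_group (tensor_group A M N)" unfolding T by (rule F.abelian_FactGroup[OF K])
  have eq: "K #>\<^bsub>F\<^esub> x = K #>\<^bsub>F\<^esub> y" if "x - y \<in> K" "x \<in> carrier F" "y \<in> carrier F" for x y
  proof -
    have "x \<in> K #>\<^bsub>F\<^esub> y" using that by (auto simp: mF K.rcos_module)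
    then show ?thesis using F.repr_independence[OF _ that(3) K] by simp
  qed
  have sum: "K #>\<^bsub>F\<^esub> x <#>\<^bsub>F\<^esub> (K #>\<^bsub>F\<^esub> y) = K #>\<^bsub>F\<^esub> (x + y)" if "x \<in> carrier F" "y \<in> carrier F" for x y
    using that by (simp add: K.rcos_sum aF)
  show "pure_tensor A M N \<in> balanced_maps A M N (tensor_group A M N)"
  proof (rule balanced_mapsI, goal_cases)
    case (1 m n) then show ?case unfolding T P by (auto simp: carrier_FactGroup fF)
  next
    case (2 m m' n)
    then have "frag_of (m \<otimes>\<^bsub>M\<^esub> m', n) - (frag_of (m, n) + frag_of (m', n)) \<in> K"
      by (intro relK) (auto simp: tensor_relations_def)
    then show ?case using 2 unfolding T P by (simp add: sum fF pF eq)
  next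
    case (3 m n n')
    then have "frag_of (m, n \<otimes>\<^bsub>N\<^esub> n') - (frag_of (m, n) + frag_of (m, n')) \<in> K"
      by (intro relK) (auto simp: tensor_relations_def)
    then show ?case using 3 unfolding T P by (simp add: sum fF pF eq)
  next
    case (4 m a n)
    then have "frag_of (ract M m a, n) - frag_of (m, lact N a n) \<in> K"
      by (intro relK) (auto simp: tensor_relations_def)
    then show ?case using 4 unfolding T P by (intro eq) (auto simp: fF rc lc)
  qed
qed

lemmas pure_tensorD = balanced_mapsD[OF pure_tensor_balanced]

lemma tensor_lift:
  assumes "is_right_module A M" "is_bimodule A N" "comm_group X" "f \<in> balanced_maps A M N X"
  shows tensor_lift_hom: "tensor_lift A M N X f \<in> hom (tensor_group A M N) X"
    and tensor_lift_pure: "\<And>m n. m \<in> carrier M \<Longrightarrow> n \<in> carrier N \<Longrightarrow>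
           tensor_lift A M N X f (pure_tensor A M N m n) = f m n"
  using theI'[OF tensor_lift_ex1[OF assms(1-3) balanced_mapsD[OF assms(4)]]]
  by (auto simp: tensor_lift_def)

lemma ex1_unique: "\<exists>!x. P x \<Longrightarrow> P x \<Longrightarrow> P y \<Longrightarrow> x = y"
  by blast

text \<open>
  Restricting a homomorphism \<open>h\<close> to the carrier makes it a lift of \<open>\<lambda>m n. h (m \<otimes> n)\<close>, and lifts are
  unique. This is the form in which the universal property is used below.
\<close>

lemma tensor_hom_eqI:
  assumes "is_right_module A M" "is_bimodule A N" "comm_group X"
    and h: "h \<in> hom (tensor_group A M N) X" and k: "k \<in> hom (tensor_group A M N) X"
    and eq: "\<And>m n. m \<in> carrier M \<Longrightarrow> n \<in> carrier N \<Longrightarrow>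
      h (pure_tensor A M N m n) = k (pure_tensor A M N m n)"
    and t: "t \<in> carrier (tensor_group A M N)"
  shows "h t = k t"
proof -
  let ?T = "tensor_group A M N"
  interpret T: comm_group ?T by (rule comm_group_tensor) fact+
  have r: "restrict g (carrier ?T) \<in> hom ?T X" if "g \<in> hom ?T X" for g
    using that by (auto simp: hom_def Pi_def)
  have "restrict h (carrier ?T) = restrict k (carrier ?T)"
    using tensor_lift_ex1[OF assms(1-3)
        balanced_mapsD[OF balanced_maps_hom[OF pure_tensor_balanced[OF assms(1,2)] h]]]
    by (rule ex1_unique) (auto simp: r h k eq pure_tensorD(1)[OF assms(1,2)])
  then show ?thesis using t by (metis restrict_apply')
qed

lemma hom_id: "(\<lambda>x. x) \<in> hom X X"
  by (simp add: hom_def)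

lemma hom_comp: "f \<in> hom X Y \<Longrightarrow> g \<in> hom Y Z \<Longrightarrow> (\<lambda>x. g (f x)) \<in> hom X Z"
  by (auto simp: hom_def Pi_def)

lemma hom_pointwise_mult:
  assumes "comm_group Y" "f \<in> hom X Y" "g \<in> hom X Y"
  shows "(\<lambda>x. f x \<otimes>\<^bsub>Y\<^esub> g x) \<in> hom X Y"
proof -
  interpret comm_group Y by fact
  show ?thesis using assms(2,3) by (auto simp: hom_def Pi_def m_ac)
qed

lemma tensor_map_balanced:
  assumes "is_right_module A M'" "is_bimodule A N'"
    "f \<in> right_linear_maps A M M'" "g \<in> left_linear_maps A N N'"
  shows "(\<lambda>m n. pure_tensor A M' N' (f m) (g n)) \<in> balanced_maps A M N (tensor_group A M' N')"
  by (rule balanced_maps_linear[OF pure_tensor_balanced]) fact+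

lemma
  assumes "is_right_module A M" "is_bimodule A N" "is_right_module A M'" "is_bimodule A N'"
    "f \<in> right_linear_maps A M M'" "g \<in> left_linear_maps A N N'"
  shows tensor_map_hom: "tensor_map A M N M' N' f g \<in> hom (tensor_group A M N) (tensor_group A M' N')"
    and tensor_map_pure: "\<And>m n. m \<in> carrier M \<Longrightarrow> n \<in> carrier N \<Longrightarrow>
      tensor_map A M N M' N' f g (pure_tensor A M N m n) = pure_tensor A M' N' (f m) (g n)"
  unfolding tensor_map_def
  by (rule tensor_lift_hom tensor_lift_pure;
      (rule assms tensor_map_balanced comm_group_tensor | assumption)+)+

section \<open>Tensor products as modules and bimodules\<close>

lemma right_tensor_simps [simp]:
  "carrier (right_tensor A M N) = carrier (tensor_group A M N)"
  "monoid.mult (right_tensor A M N) = monoid.mult (tensor_group A M N)"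
  "one (right_tensor A M N) = one (tensor_group A M N)"
  by (simp_all add: right_tensor_def)

lemma bimodule_tensor_simps [simp]:
  "carrier (bimodule_tensor A M N) = carrier (tensor_group A M N)"
  "monoid.mult (bimodule_tensor A M N) = monoid.mult (tensor_group A M N)"
  "one (bimodule_tensor A M N) = one (tensor_group A M N)"
  "ract (bimodule_tensor A M N) = ract (right_tensor A M N)"
  by (simp_all add: bimodule_tensor_def)

lemma hom_right_tensor [simp]:
  "hom (right_tensor A M N) X = hom (tensor_group A M N) X"
  "hom X (right_tensor A M N) = hom X (tensor_group A M N)"
  by (simp_all add: hom_def)

lemma hom_bimodule_tensor [simp]:
  "hom (bimodule_tensor A M N) X = hom (tensor_group A M N) X"
  "hom X (bimodule_tensor A M N) = hom X (tensor_group A M N)"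
  by (simp_all add: hom_def)

lemma ract_right_tensor: "ract (right_tensor A M N) t a = tensor_map A M N M N id (\<lambda>n. ract N n a) t"
  by (simp add: right_tensor_def tensor_map_def)

lemma lact_bimodule_tensor: "lact (bimodule_tensor A M N) a t = tensor_map A M N M N (lact M a) id t"
  by (simp add: bimodule_tensor_def tensor_map_def)

lemma
  assumes M: "is_right_module A M" and N: "is_bimodule A N" and a: "a \<in> carrier A"
  shows ract_tensor_hom: "(\<lambda>t. ract (right_tensor A M N) t a) \<in> hom (tensor_group A M N) (tensor_group A M N)"
    and ract_tensor_pure: "m \<in> carrier M \<Longrightarrow> n \<in> carrier N \<Longrightarrow>
      ract (right_tensor A M N) (pure_tensor A M N m n) a = pure_tensor A M N m (ract N n a)"
  unfolding ract_right_tensor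
  using tensor_map_hom[OF M N M N id_linear(1) ract_left_linear[OF N a]]
    tensor_map_pure[OF M N M N id_linear(1) ract_left_linear[OF N a]] by auto

lemma
  assumes M: "is_bimodule A M" and N: "is_bimodule A N" and a: "a \<in> carrier A"
  shows lact_tensor_hom: "lact (bimodule_tensor A M N) a \<in> hom (tensor_group A M N) (tensor_group A M N)"
    and lact_tensor_pure: "m \<in> carrier M \<Longrightarrow> n \<in> carrier N \<Longrightarrow>
      lact (bimodule_tensor A M N) a (pure_tensor A M N m n) = pure_tensor A M N (lact M a m) n"
  unfolding lact_bimodule_tensor
  using tensor_map_hom[OF is_bimoduleD(1)[OF M] N is_bimoduleD(1)[OF M] N lact_right_linear[OF M a] id_linear(2)]
    tensor_map_pure[OF is_bimoduleD(1)[OF M] N is_bimoduleD(1)[OF M] N lact_right_linear[OF M a] id_linear(2)]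
  by (auto simp: lact_bimodule_tensor hom_def Pi_def)

lemma is_right_module_tensor:
  assumes A: "ring A" and M: "is_right_module A M" and N: "is_bimodule A N"
  shows "is_right_module A (right_tensor A M N)"
proof -
  let ?T = "tensor_group A M N"
  interpret A: ring A by fact
  have T: "comm_group ?T" by (rule comm_group_tensor[OF M N])
  note h = ract_tensor_hom[OF M N] and p = ract_tensor_pure[OF M N]
  note NR = is_right_moduleD[OF is_bimoduleD(1)[OF N]]
  note ext = tensor_hom_eqI[OF M N T]
  have 1: "comm_group (right_tensor A M N)" by (rule comm_group_cong[OF T]) auto
  have 2: "ract (right_tensor A M N) t (a \<oplus>\<^bsub>A\<^esub> b) =
      ract (right_tensor A M N) t a \<otimes>\<^bsub>?T\<^esub> ract (right_tensor A M N) t b"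
    if "t \<in> carrier ?T" "a \<in> carrier A" "b \<in> carrier A" for t a b
    by (rule ext) (use that in \<open>auto intro!: h hom_pointwise_mult T simp: p NR pure_tensorD[OF M N]\<close>)
  have 3: "ract (right_tensor A M N) t (a \<otimes>\<^bsub>A\<^esub> b) =
      ract (right_tensor A M N) (ract (right_tensor A M N) t a) b"
    if "t \<in> carrier ?T" "a \<in> carrier A" "b \<in> carrier A" for t a b
    by (rule ext) (use that in \<open>auto intro!: h hom_comp[OF h h] simp: p NR pure_tensorD[OF M N]\<close>)
  have 4: "ract (right_tensor A M N) t \<one>\<^bsub>A\<^esub> = t" if "t \<in> carrier ?T" for t
    by (rule ext) (use that in \<open>auto intro!: h hom_id simp: p NR pure_tensorD[OF M N]\<close>)
  show ?thesis
    unfolding is_right_module_def using 1 h 2 3 4 hom_in_carrier[OF h] by (auto simp: hom_def[of "add_monoid A"])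
qed

lemma is_bimodule_tensor:
  assumes A: "ring A" and M: "is_bimodule A M" and N: "is_bimodule A N"
  shows "is_bimodule A (bimodule_tensor A M N)"
proof -
  let ?T = "tensor_group A M N"
  interpret A: ring A by fact
  note M' = is_bimoduleD(1)[OF M]
  have T: "comm_group ?T" by (rule comm_group_tensor[OF M' N])
  note h = lact_tensor_hom[OF M N] and p = lact_tensor_pure[OF M N]
  note h' = ract_tensor_hom[OF M' N] and p' = ract_tensor_pure[OF M' N]
  note NR = is_right_moduleD[OF is_bimoduleD(1)[OF N]]
  note MD = is_bimoduleD[OF M]
  note ext = tensor_hom_eqI[OF M' N T]
  have 1: "is_right_module A (bimodule_tensor A M N)"
    using is_right_module_tensor[OF A M' N] comm_group_cong[OF T, of "bimodule_tensor A M N"]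
    unfolding is_right_module_def by (auto simp: hom_def)
  have 2: "lact (bimodule_tensor A M N) (a \<oplus>\<^bsub>A\<^esub> b) t =
      lact (bimodule_tensor A M N) a t \<otimes>\<^bsub>?T\<^esub> lact (bimodule_tensor A M N) b t"
    if "t \<in> carrier ?T" "a \<in> carrier A" "b \<in> carrier A" for t a b
    by (rule ext) (use that in \<open>auto intro!: h hom_pointwise_mult T simp: p MD pure_tensorD[OF M' N]\<close>)
  have 3: "lact (bimodule_tensor A M N) (a \<otimes>\<^bsub>A\<^esub> b) t =
      lact (bimodule_tensor A M N) a (lact (bimodule_tensor A M N) b t)"
    if "t \<in> carrier ?T" "a \<in> carrier A" "b \<in> carrier A" for t a b
    by (rule ext) (use that in \<open>auto intro!: h hom_comp[OF h h] simp: p MD pure_tensorD[OF M' N]\<close>)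
  have 4: "lact (bimodule_tensor A M N) \<one>\<^bsub>A\<^esub> t = t" if "t \<in> carrier ?T" for t
    by (rule ext) (use that in \<open>auto intro!: h hom_id simp: p MD pure_tensorD[OF M' N]\<close>)
  have 5: "ract (right_tensor A M N) (lact (bimodule_tensor A M N) a t) b =
      lact (bimodule_tensor A M N) a (ract (right_tensor A M N) t b)"
    if "t \<in> carrier ?T" "a \<in> carrier A" "b \<in> carrier A" for t a b
    by (rule ext[OF hom_comp[OF h h'] hom_comp[OF h' h]])
       (use that in \<open>auto simp: p p' MD NR pure_tensorD[OF M' N]\<close>)
  show ?thesis
    unfolding is_bimodule_def using 1 h 2 3 4 5 hom_in_carrier[OF h]
    by (auto simp: hom_def[of "add_monoid A"])
qed

section \<open>Functoriality and the associator\<close>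

lemma tensor_map_right_linear:
  assumes M: "is_right_module A M" and N: "is_bimodule A N"
    and M': "is_right_module A M'" and N': "is_bimodule A N'"
    and f: "f \<in> right_linear_maps A M M'" and g: "g \<in> bimodule_maps A N N'"
  shows "tensor_map A M N M' N' f g \<in> right_linear_maps A (right_tensor A M N) (right_tensor A M' N')"
proof -
  note gR = right_linear_mapsD[OF bimodule_mapsD(1)[OF g]]
  note gL = left_linear_mapsD[OF bimodule_mapsD(2)[OF g]]
  note h = tensor_map_hom[OF M N M' N' f bimodule_mapsD(2)[OF g]]
  note p = tensor_map_pure[OF M N M' N' f bimodule_mapsD(2)[OF g]]
  note NR = is_right_moduleD[OF is_bimoduleD(1)[OF N]]
  have "tensor_map A M N M' N' f g (ract (right_tensor A M N) t a) =
      ract (right_tensor A M' N') (tensor_map A M N M' N' f g t) a"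
    if "t \<in> carrier (tensor_group A M N)" and a: "a \<in> carrier A" for t a
    by (rule tensor_hom_eqI[OF M N comm_group_tensor[OF M' N']
          hom_comp[OF ract_tensor_hom[OF M N a] h] hom_comp[OF h ract_tensor_hom[OF M' N' a]] _ that(1)])
      (simp add: ract_tensor_pure[OF M N a] ract_tensor_pure[OF M' N' a] p NR gR a
         right_linear_mapsD[OF f])
  then show ?thesis using h by (simp add: right_linear_maps_def)
qed

lemma tensor_map_bimodule:
  assumes M: "is_bimodule A M" and N: "is_bimodule A N"
    and M': "is_bimodule A M'" and N': "is_bimodule A N'"
    and f: "f \<in> bimodule_maps A M M'" and g: "g \<in> bimodule_maps A N N'"
  shows "tensor_map A M N M' N' f g \<in> bimodule_maps A (bimodule_tensor A M N) (bimodule_tensor A M' N')"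
proof -
  note m = is_bimoduleD(1)[OF M] and m' = is_bimoduleD(1)[OF M']
  note fR = bimodule_mapsD(1)[OF f]
  note fD = right_linear_mapsD[OF fR] left_linear_mapsD[OF bimodule_mapsD(2)[OF f]]
  note gL = bimodule_mapsD(2)[OF g]
  note h = tensor_map_hom[OF m N m' N' fR gL]
  note p = tensor_map_pure[OF m N m' N' fR gL]
  have "tensor_map A M N M' N' f g (lact (bimodule_tensor A M N) a t) =
      lact (bimodule_tensor A M' N') a (tensor_map A M N M' N' f g t)"
    if "t \<in> carrier (tensor_group A M N)" and a: "a \<in> carrier A" for t a
    by (rule tensor_hom_eqI[OF m N comm_group_tensor[OF m' N']
          hom_comp[OF lact_tensor_hom[OF M N a] h] hom_comp[OF h lact_tensor_hom[OF M' N' a]] _ that(1)])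
      (simp add: lact_tensor_pure[OF M N a] lact_tensor_pure[OF M' N' a] p is_bimoduleD[OF M] fD a
         left_linear_mapsD[OF gL])
  then show ?thesis
    using h right_linear_mapsD[OF tensor_map_right_linear[OF m N m' N' fR g]]
    by (auto simp: bimodule_maps_def right_linear_maps_def)
qed

lemma tensor_map_comp:
  assumes M: "is_right_module A M" and N: "is_bimodule A N"
    and M': "is_right_module A M'" and N': "is_bimodule A N'"
    and M'': "is_right_module A M''" and N'': "is_bimodule A N''"
    and f: "f \<in> right_linear_maps A M M'" and g: "g \<in> left_linear_maps A N N'"
    and f': "f' \<in> right_linear_maps A M' M''" and g': "g' \<in> left_linear_maps A N' N''"
    and t: "t \<in> carrier (tensor_group A M N)"
  shows "tensor_map A M' N' M'' N'' f' g' (tensor_map A M N M' N' f g t) =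
    tensor_map A M N M'' N'' (f' \<circ> f) (g' \<circ> g) t"
  by (rule tensor_hom_eqI[OF M N comm_group_tensor[OF M'' N'']
        hom_comp[OF tensor_map_hom[OF M N M' N' f g] tensor_map_hom[OF M' N' M'' N'' f' g']]
        tensor_map_hom[OF M N M'' N'' right_linear_comp[OF f f'] left_linear_comp[OF g g']] _ t])
     (simp add: tensor_map_pure[OF M N M' N' f g] tensor_map_pure[OF M' N' M'' N'' f' g']
        tensor_map_pure[OF M N M'' N'' right_linear_comp[OF f f'] left_linear_comp[OF g g']]
        right_linear_mapsD[OF f] left_linear_mapsD[OF g])

lemma tensor_map_cong:
  assumes M: "is_right_module A M" and N: "is_bimodule A N"
    and M': "is_right_module A M'" and N': "is_bimodule A N'"
    and f: "f \<in> right_linear_maps A M M'" "f' \<in> right_linear_maps A M M'"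
    and g: "g \<in> left_linear_maps A N N'" "g' \<in> left_linear_maps A N N'"
    and eq: "\<And>m. m \<in> carrier M \<Longrightarrow> f m = f' m" "\<And>n. n \<in> carrier N \<Longrightarrow> g n = g' n"
    and t: "t \<in> carrier (tensor_group A M N)"
  shows "tensor_map A M N M' N' f g t = tensor_map A M N M' N' f' g' t"
  by (rule tensor_hom_eqI[OF M N comm_group_tensor[OF M' N']
        tensor_map_hom[OF M N M' N' f(1) g(1)] tensor_map_hom[OF M N M' N' f(2) g(2)] _ t])
     (simp add: tensor_map_pure[OF M N M' N'] f g eq)

lemma tensor_map_id:
  assumes M: "is_right_module A M" and N: "is_bimodule A N"
    and f: "f \<in> right_linear_maps A M M" and g: "g \<in> left_linear_maps A N N"
    and eq: "\<And>m. m \<in> carrier M \<Longrightarrow> f m = m" "\<And>n. n \<in> carrier N \<Longrightarrow> g n = n"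
    and t: "t \<in> carrier (tensor_group A M N)"
  shows "tensor_map A M N M N f g t = t"
  by (rule tensor_hom_eqI[OF M N comm_group_tensor[OF M N] tensor_map_hom[OF M N M N f g] hom_id _ t])
     (simp add: tensor_map_pure[OF M N M N f g] eq)

text \<open>
  For a fixed \<open>p\<close> both sides are homomorphisms in the element \<open>t\<close> of \<open>M \<otimes> N\<close>, so agreement on
  \<open>t \<otimes> p\<close> follows from agreement on \<open>(m \<otimes> n) \<otimes> p\<close>.
\<close>

lemma triple_tensor_hom_eqI:
  assumes A: "ring A" and M: "is_right_module A M" and N: "is_bimodule A N" and P: "is_bimodule A P"
    and X: "comm_group X"
    and h: "h \<in> hom (tensor_group A (right_tensor A M N) P) X"
    and k: "k \<in> hom (tensor_group A (right_tensor A M N) P) X"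
    and eq: "\<And>m n p. m \<in> carrier M \<Longrightarrow> n \<in> carrier N \<Longrightarrow> p \<in> carrier P \<Longrightarrow>
      h (pure_tensor A (right_tensor A M N) P (pure_tensor A M N m n) p) =
      k (pure_tensor A (right_tensor A M N) P (pure_tensor A M N m n) p)"
    and s: "s \<in> carrier (tensor_group A (right_tensor A M N) P)"
  shows "h s = k s"
proof (rule tensor_hom_eqI[OF is_right_module_tensor[OF A M N] P X h k _ s])
  fix t p assume t: "t \<in> carrier (right_tensor A M N)" and p: "p \<in> carrier P"
  have "(\<lambda>t. pure_tensor A (right_tensor A M N) P t p)
      \<in> hom (tensor_group A M N) (tensor_group A (right_tensor A M N) P)"
    using pure_tensorD[OF is_right_module_tensor[OF A M N] P] p by (auto simp: hom_def)
  from tensor_hom_eqI[OF M N X hom_comp[OF this h] hom_comp[OF this k]] eq p t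
  show "h (pure_tensor A (right_tensor A M N) P t p) = k (pure_tensor A (right_tensor A M N) P t p)"
    by simp
qed

text \<open>
  The associator is a lift whose values are themselves lifts: for each \<open>p\<close> the map
  \<open>m \<otimes> n \<mapsto> m \<otimes> (n \<otimes> p)\<close> exists, and the resulting map of \<open>(t, p)\<close> is balanced because the identities
  required of it hold when \<open>t\<close> is pure.
\<close>

lemma
  assumes A: "ring A" and M: "is_right_module A M" and N: "is_bimodule A N" and P: "is_bimodule A P"
  shows associator_hom: "associator A M N P \<in>
      hom (tensor_group A (right_tensor A M N) P) (tensor_group A M (bimodule_tensor A N P))"
    and associator_pure: "\<And>m n p. m \<in> carrier M \<Longrightarrow> n \<in> carrier N \<Longrightarrow> p \<in> carrier P \<Longrightarrow>
      associator A M N P (pure_tensor A (right_tensor A M N) P (pure_tensor A M N m n) p) =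
      pure_tensor A M (bimodule_tensor A N P) m (pure_tensor A N P n p)"
proof -
  let ?NP = "bimodule_tensor A N P"
  let ?X = "tensor_group A M ?NP"
  let ?f = "\<lambda>p m n. pure_tensor A M ?NP m (pure_tensor A N P n p)"
  let ?F = "\<lambda>t p. tensor_lift A M N ?X (?f p) t"
  note NP = is_bimodule_tensor[OF A N P] and MN = is_right_module_tensor[OF A M N]
  note X = comm_group_tensor[OF M NP]
  note N' = is_bimoduleD(1)[OF N] and P' = is_bimoduleD(1)[OF P]
  note pNP = pure_tensorD[OF N' P]
  have pNP4: "pure_tensor A N P (lact N a n) p = lact ?NP a (pure_tensor A N P n p)"
    if "n \<in> carrier N" "p \<in> carrier P" "a \<in> carrier A" for a n p
    using that by (simp add: lact_tensor_pure[OF N P])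
  have f: "?f p \<in> balanced_maps A M N ?X" if "p \<in> carrier P" for p
    using that by (intro balanced_mapsI)
       (simp_all add: pNP4 pNP pure_tensorD[OF M NP, simplified])
  note lh = tensor_lift_hom[OF M N X f] and lp = tensor_lift_pure[OF M N X f]
  have F: "?F \<in> balanced_maps A (right_tensor A M N) P ?X"
  proof (rule balanced_mapsI, goal_cases)
    case (1 t p) then show ?case using hom_in_carrier[OF lh] by simp
  next
    case (2 t t' p) then show ?case using hom_mult[OF lh] by simp
  next
    case (3 t p p')
    interpret P: comm_group P by (rule is_right_moduleD(1)[OF P'])
    have pp: "p \<otimes>\<^bsub>P\<^esub> p' \<in> carrier P" using 3 by simp
    show ?case
      by (rule tensor_hom_eqI[OF M N X lh[OF pp] hom_pointwise_mult[OF X lh[OF 3(2)] lh[OF 3(3)]]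
            _ 3(1)[simplified]])
        (simp add: lp pp 3 pNP pure_tensorD[OF M NP, simplified])
  next
    case (4 t a p)
    have ap: "lact P a p \<in> carrier P" using 4 is_bimoduleD(2)[OF P] by simp
    show ?case
      by (rule tensor_hom_eqI[OF M N X hom_comp[OF ract_tensor_hom[OF M N 4(2)] lh[OF 4(3)]] lh[OF ap]
            _ 4(1)[simplified]])
        (simp add: lp ap 4 is_right_moduleD(2)[OF N'] ract_tensor_pure[OF M N] pNP)
  qed
  have eq: "associator A M N P = tensor_lift A (right_tensor A M N) P ?X ?F"
    by (simp add: associator_def Let_def)
  show "associator A M N P \<in> hom (tensor_group A (right_tensor A M N) P) ?X"
    unfolding eq by (rule tensor_lift_hom[OF MN P X F])
  show "associator A M N P (pure_tensor A (right_tensor A M N) P (pure_tensor A M N m n) p) =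
      pure_tensor A M ?NP m (pure_tensor A N P n p)"
    if "m \<in> carrier M" "n \<in> carrier N" "p \<in> carrier P" for m n p
    using that unfolding eq
    by (simp add: tensor_lift_pure[OF MN P X F] lp pure_tensorD[OF M N])
qed

lemma associator_natural:
  assumes A: "ring A" and M: "is_right_module A M" and N: "is_bimodule A N" and P: "is_bimodule A P"
    and M': "is_right_module A M'" and N': "is_bimodule A N'" and P': "is_bimodule A P'"
    and f: "f \<in> right_linear_maps A M M'" and g: "g \<in> bimodule_maps A N N'"
    and h: "h \<in> bimodule_maps A P P'"
    and s: "s \<in> carrier (tensor_group A (right_tensor A M N) P)"
  shows "associator A M' N' P'
      (tensor_map A (right_tensor A M N) P (right_tensor A M' N') P' (tensor_map A M N M' N' f g) h s) =
    tensor_map A M (bimodule_tensor A N P) M' (bimodule_tensor A N' P') f (tensor_map A N P N' P' g h)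
      (associator A M N P s)"
proof -
  note n = is_bimoduleD(1)[OF N] and n' = is_bimoduleD(1)[OF N']
  note gR = bimodule_mapsD(1)[OF g] and gL = bimodule_mapsD(2)[OF g] and hL = bimodule_mapsD(2)[OF h]
  note MN = is_right_module_tensor[OF A M N] and MN' = is_right_module_tensor[OF A M' N']
  note NP = is_bimodule_tensor[OF A N P] and NP' = is_bimodule_tensor[OF A N' P']
  note fg = tensor_map_right_linear[OF M N M' N' f g]
  note gh = bimodule_mapsD(2)[OF tensor_map_bimodule[OF N P N' P' g h]]
  show ?thesis
    by (rule triple_tensor_hom_eqI[OF A M N P comm_group_tensor[OF M' NP'] _ _ _ s])
       (auto intro!: hom_comp[OF tensor_map_hom associator_hom] hom_comp[OF associator_hom tensor_map_hom]
             A M N P M' N' P' MN NP MN' NP' f fg hL gh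
        simp: tensor_map_pure[OF MN P MN' P' fg hL] tensor_map_pure[OF M NP M' NP' f gh]
          tensor_map_pure[OF M N M' N' f gL] tensor_map_pure[OF n P n' P' gR hL]
          associator_pure[OF A M N P] associator_pure[OF A M' N' P']
          pure_tensorD[OF M N] pure_tensorD[OF n P]
          right_linear_mapsD[OF f] left_linear_mapsD[OF gL] left_linear_mapsD[OF hL])
qed

section \<open>Contraction against a bimodule map into \<open>A\<close>\<close>

text \<open>
  For \<open>e : C \<rightarrow> A\<close> these are \<open>m \<otimes> c \<mapsto> m e(c)\<close> and \<open>c \<otimes> m \<mapsto> e(c) m\<close>, that is, \<open>M \<otimes> e\<close> and
  \<open>e \<otimes> M\<close> followed by a unitor. Treating each composite as one map keeps the regular bimodule out
  of the computations with triple tensor products.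
\<close>

definition right_contraction ::
  "('a, 'z) ring_scheme \<Rightarrow> ('a, 'm, 'x) right_module_scheme \<Rightarrow> ('a, 'n, 'y) bimodule_scheme
    \<Rightarrow> ('n \<Rightarrow> 'a) \<Rightarrow> ('m, 'n) tensor \<Rightarrow> 'm" where
  "right_contraction A M C e = tensor_lift A M C M (\<lambda>m c. ract M m (e c))"

definition left_contraction ::
  "('a, 'z) ring_scheme \<Rightarrow> ('a, 'n, 'x) bimodule_scheme \<Rightarrow> ('a, 'm, 'y) bimodule_scheme
    \<Rightarrow> ('n \<Rightarrow> 'a) \<Rightarrow> ('n, 'm) tensor \<Rightarrow> 'm" where
  "left_contraction A C M e = tensor_lift A C M M (\<lambda>c m. lact M (e c) m)"

lemma
  assumes M: "is_right_module A M" and C: "is_bimodule A C"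
    and e: "e \<in> bimodule_maps A C (regular_bimodule A)"
  shows right_contraction_hom: "right_contraction A M C e \<in> hom (tensor_group A M C) M"
    and right_contraction_pure: "\<And>m c. m \<in> carrier M \<Longrightarrow> c \<in> carrier C \<Longrightarrow>
      right_contraction A M C e (pure_tensor A M C m c) = ract M m (e c)"
    and right_contraction_linear: "right_contraction A M C e \<in> right_linear_maps A (right_tensor A M C) M"
proof -
  note eD = right_linear_mapsD[OF bimodule_mapsD(1)[OF e], simplified]
    left_linear_mapsD[OF bimodule_mapsD(2)[OF e], simplified]
  note MD = is_right_moduleD[OF M]
  note CD = is_right_moduleD[OF is_bimoduleD(1)[OF C]]
  have b: "(\<lambda>m c. ract M m (e c)) \<in> balanced_maps A M C M"
    by (rule balanced_mapsI) (auto simp: eD MD)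
  show h: "right_contraction A M C e \<in> hom (tensor_group A M C) M"
    and p: "\<And>m c. m \<in> carrier M \<Longrightarrow> c \<in> carrier C \<Longrightarrow>
      right_contraction A M C e (pure_tensor A M C m c) = ract M m (e c)"
    unfolding right_contraction_def
    by (auto intro!: tensor_lift_hom tensor_lift_pure M C MD b)
  have "right_contraction A M C e (ract (right_tensor A M C) t a) = ract M (right_contraction A M C e t) a"
    if "t \<in> carrier (tensor_group A M C)" and a: "a \<in> carrier A" for t a
    by (rule tensor_hom_eqI[OF M C MD(1) hom_comp[OF ract_tensor_hom[OF M C a] h]
          hom_comp[OF h MD(7)[OF a]] _ that(1)])
       (simp add: ract_tensor_pure[OF M C a] p CD a eD MD)
  then show "right_contraction A M C e \<in> right_linear_maps A (right_tensor A M C) M"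
    using h by (simp add: right_linear_maps_def)
qed

lemma
  assumes C: "is_bimodule A C" and M: "is_bimodule A M"
    and e: "e \<in> bimodule_maps A C (regular_bimodule A)"
  shows left_contraction_hom: "left_contraction A C M e \<in> hom (tensor_group A C M) M"
    and left_contraction_pure: "\<And>m c. c \<in> carrier C \<Longrightarrow> m \<in> carrier M \<Longrightarrow>
      left_contraction A C M e (pure_tensor A C M c m) = lact M (e c) m"
    and left_contraction_linear: "left_contraction A C M e \<in> left_linear_maps A (bimodule_tensor A C M) M"
proof -
  note eD = right_linear_mapsD[OF bimodule_mapsD(1)[OF e], simplified]
    left_linear_mapsD[OF bimodule_mapsD(2)[OF e], simplified]
  note MD = is_bimoduleD[OF M] and M1 = is_right_moduleD(1)[OF is_bimoduleD(1)[OF M]]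
  note CD = is_bimoduleD[OF C]
  have b: "(\<lambda>c m. lact M (e c) m) \<in> balanced_maps A C M M"
    by (rule balanced_mapsI) (auto simp: eD MD)
  show h: "left_contraction A C M e \<in> hom (tensor_group A C M) M"
    and p: "\<And>m c. c \<in> carrier C \<Longrightarrow> m \<in> carrier M \<Longrightarrow>
      left_contraction A C M e (pure_tensor A C M c m) = lact M (e c) m"
    unfolding left_contraction_def
    by (auto intro!: tensor_lift_hom tensor_lift_pure M CD M1 b)
  have "left_contraction A C M e (lact (bimodule_tensor A C M) a t) = lact M a (left_contraction A C M e t)"
    if "t \<in> carrier (tensor_group A C M)" and a: "a \<in> carrier A" for t a
    by (rule tensor_hom_eqI[OF CD(1) M M1 hom_comp[OF lact_tensor_hom[OF C M a] h]
          hom_comp[OF h MD(8)[OF a]] _ that(1)])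
       (simp add: lact_tensor_pure[OF C M a] p CD a eD MD)
  then show "left_contraction A C M e \<in> left_linear_maps A (bimodule_tensor A C M) M"
    using h by (simp add: left_linear_maps_def)
qed

lemma right_contraction_natural:
  assumes M: "is_right_module A M" and C: "is_bimodule A C"
    and N: "is_right_module A N" and D: "is_bimodule A D"
    and e: "e \<in> bimodule_maps A D (regular_bimodule A)"
    and f: "f \<in> right_linear_maps A M N" and g: "g \<in> bimodule_maps A C D"
    and t: "t \<in> carrier (tensor_group A M C)"
  shows "right_contraction A N D e (tensor_map A M C N D f g t) =
    f (right_contraction A M C (e \<circ> g) t)"
proof -
  note gL = bimodule_mapsD(2)[OF g] and eg = bimodule_maps_comp[OF g e]
  note eD = right_linear_mapsD[OF bimodule_mapsD(1)[OF e], simplified]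
  show ?thesis
    by (rule tensor_hom_eqI[OF M C is_right_moduleD(1)[OF N]
          hom_comp[OF tensor_map_hom[OF M C N D f gL] right_contraction_hom[OF N D e]]
          hom_comp[OF right_contraction_hom[OF M C eg] right_linear_mapsD(1)[OF f]] _ t])
       (simp add: tensor_map_pure[OF M C N D f gL] right_contraction_pure[OF N D e]
          right_contraction_pure[OF M C eg] right_linear_mapsD[OF f] left_linear_mapsD[OF gL] eD)
qed

lemma left_contraction_natural:
  assumes C: "is_bimodule A C" and M: "is_bimodule A M"
    and D: "is_bimodule A D" and N: "is_bimodule A N"
    and e: "e \<in> bimodule_maps A D (regular_bimodule A)"
    and f: "f \<in> bimodule_maps A C D" and g: "g \<in> left_linear_maps A M N"
    and t: "t \<in> carrier (tensor_group A C M)"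
  shows "left_contraction A D N e (tensor_map A C M D N f g t) =
    g (left_contraction A C M (e \<circ> f) t)"
proof -
  note c = is_bimoduleD(1)[OF C] and d = is_bimoduleD(1)[OF D]
  note fR = bimodule_mapsD(1)[OF f] and ef = bimodule_maps_comp[OF f e]
  note eD = right_linear_mapsD[OF bimodule_mapsD(1)[OF e], simplified]
  show ?thesis
    by (rule tensor_hom_eqI[OF c M is_right_moduleD(1)[OF is_bimoduleD(1)[OF N]]
          hom_comp[OF tensor_map_hom[OF c M d N fR g] left_contraction_hom[OF D N e]]
          hom_comp[OF left_contraction_hom[OF C M ef] left_linear_mapsD(1)[OF g]] _ t])
       (simp add: tensor_map_pure[OF c M d N fR g] left_contraction_pure[OF D N e]
          left_contraction_pure[OF C M ef] right_linear_mapsD[OF fR] left_linear_mapsD[OF g] eD)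
qed

lemma right_contraction_cong:
  assumes M: "is_right_module A M" and C: "is_bimodule A C"
    and e: "e \<in> bimodule_maps A C (regular_bimodule A)"
    and e': "e' \<in> bimodule_maps A C (regular_bimodule A)"
    and eq: "\<And>c. c \<in> carrier C \<Longrightarrow> e c = e' c"
    and t: "t \<in> carrier (tensor_group A M C)"
  shows "right_contraction A M C e t = right_contraction A M C e' t"
  by (rule tensor_hom_eqI[OF M C is_right_moduleD(1)[OF M] right_contraction_hom[OF M C e]
        right_contraction_hom[OF M C e'] _ t])
     (simp add: right_contraction_pure[OF M C e] right_contraction_pure[OF M C e'] eq)

lemma left_contraction_cong:
  assumes C: "is_bimodule A C" and M: "is_bimodule A M"
    and e: "e \<in> bimodule_maps A C (regular_bimodule A)"
    and e': "e' \<in> bimodule_maps A C (regular_bimodule A)"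
    and eq: "\<And>c. c \<in> carrier C \<Longrightarrow> e c = e' c"
    and t: "t \<in> carrier (tensor_group A C M)"
  shows "left_contraction A C M e t = left_contraction A C M e' t"
  by (rule tensor_hom_eqI[OF is_bimoduleD(1)[OF C] M is_right_moduleD(1)[OF is_bimoduleD(1)[OF M]]
        left_contraction_hom[OF C M e] left_contraction_hom[OF C M e'] _ t])
     (simp add: left_contraction_pure[OF C M e] left_contraction_pure[OF C M e'] eq)

lemma right_unitor_tensor_map:
  assumes A: "ring A" and M: "is_right_module A M" and C: "is_bimodule A C"
    and e: "e \<in> bimodule_maps A C (regular_bimodule A)" and t: "t \<in> carrier (tensor_group A M C)"
  shows "right_unitor A M (tensor_map A M C M (regular_bimodule A) id e t) = right_contraction A M C e t"
  using right_contraction_natural[OF M C M is_bimodule_regular[OF A] id_linear(3) id_linear(1) e t]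
  by (simp add: right_unitor_def right_contraction_def)

lemma left_unitor_tensor_map:
  assumes A: "ring A" and C: "is_bimodule A C" and M: "is_bimodule A M"
    and e: "e \<in> bimodule_maps A C (regular_bimodule A)" and t: "t \<in> carrier (tensor_group A C M)"
  shows "left_unitor A M (tensor_map A C M (regular_bimodule A) M e id t) = left_contraction A C M e t"
  using left_contraction_natural[OF C M is_bimodule_regular[OF A] M id_linear(3) e id_linear(2) t]
  by (simp add: left_unitor_def left_contraction_def)

text \<open>
  Contracting the middle factor of \<open>M \<otimes> C \<otimes> P\<close> from the left or from the right gives the same, since
  \<open>m \<otimes> e(c) p = m e(c) \<otimes> p\<close>: the triangle identity for the unitors.
\<close>

lemma left_contraction_associator:
  assumes A: "ring A" and M: "is_right_module A M" and C: "is_bimodule A C" and P: "is_bimodule A P"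
    and e: "e \<in> bimodule_maps A C (regular_bimodule A)"
    and s: "s \<in> carrier (tensor_group A (right_tensor A M C) P)"
  shows "tensor_map A M (bimodule_tensor A C P) M P id (left_contraction A C P e) (associator A M C P s) =
    tensor_map A (right_tensor A M C) P M P (right_contraction A M C e) id s"
proof -
  note c = is_bimoduleD(1)[OF C]
  note eD = right_linear_mapsD[OF bimodule_mapsD(1)[OF e], simplified]
  note MC = is_right_module_tensor[OF A M C] and CP = is_bimodule_tensor[OF A C P]
  note l = left_contraction_linear[OF C P e] and r = right_contraction_linear[OF M C e]
  show ?thesis
    by (rule triple_tensor_hom_eqI[OF A M C P comm_group_tensor[OF M P]
          hom_comp[OF associator_hom[OF A M C P] tensor_map_hom[OF M CP M P id_linear(1) l]]
          tensor_map_hom[OF MC P M P r id_linear(2)] _ s])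
       (simp add: associator_pure[OF A M C P] tensor_map_pure[OF M CP M P id_linear(1) l]
         tensor_map_pure[OF MC P M P r id_linear(2)] pure_tensorD[OF M C] pure_tensorD[OF c P]
         pure_tensorD(4)[OF M P] eD
         left_contraction_pure[OF C P e] right_contraction_pure[OF M C e])
qed

lemma right_contraction_left_linear:
  assumes N: "is_bimodule A N" and C: "is_bimodule A C"
    and e: "e \<in> bimodule_maps A C (regular_bimodule A)"
  shows "right_contraction A N C e \<in> left_linear_maps A (bimodule_tensor A N C) N"
proof -
  note n = is_bimoduleD(1)[OF N] and ND = is_bimoduleD[OF N]
  note eD = right_linear_mapsD[OF bimodule_mapsD(1)[OF e], simplified]
  note h = right_contraction_hom[OF n C e] and p = right_contraction_pure[OF n C e]
  have "right_contraction A N C e (lact (bimodule_tensor A N C) a t) = lact N a (right_contraction A N C e t)"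
    if "t \<in> carrier (tensor_group A N C)" and a: "a \<in> carrier A" for t a
    by (rule tensor_hom_eqI[OF n C is_right_moduleD(1)[OF n] hom_comp[OF lact_tensor_hom[OF N C a] h]
          hom_comp[OF h ND(8)[OF a]] _ that(1)])
       (simp add: lact_tensor_pure[OF N C a] p a eD ND)
  then show ?thesis using h by (simp add: left_linear_maps_def)
qed

text \<open>
  Contracting the last factor does not see the bracketing, because the right action on \<open>M \<otimes> N\<close> is that
  of \<open>N\<close>.
\<close>

lemma right_contraction_associator:
  assumes A: "ring A" and M: "is_right_module A M" and N: "is_bimodule A N" and C: "is_bimodule A C"
    and e: "e \<in> bimodule_maps A C (regular_bimodule A)"
    and s: "s \<in> carrier (tensor_group A (right_tensor A M N) C)"
  shows "tensor_map A M (bimodule_tensor A N C) M N id (right_contraction A N C e) (associator A M N C s) =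
    right_contraction A (right_tensor A M N) C e s"
proof -
  note n = is_bimoduleD(1)[OF N]
  note eD = right_linear_mapsD[OF bimodule_mapsD(1)[OF e], simplified]
  note MN = is_right_module_tensor[OF A M N] and NC = is_bimodule_tensor[OF A N C]
  note l = right_contraction_left_linear[OF N C e]
  show ?thesis
    by (rule triple_tensor_hom_eqI[OF A M N C comm_group_tensor[OF M N]
          hom_comp[OF associator_hom[OF A M N C] tensor_map_hom[OF M NC M N id_linear(1) l]]
          right_contraction_hom[OF MN C e, simplified] _ s])
       (simp add: associator_pure[OF A M N C] tensor_map_pure[OF M NC M N id_linear(1) l]
         pure_tensorD[OF M N] pure_tensorD[OF n C] ract_tensor_pure[OF M N]
         right_contraction_pure[OF n C e] right_contraction_pure[OF MN C e] eD)
qed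

section \<open>Transport maps of a group comodule\<close>

text \<open>
  A cofree structure whose component at the unit of \<open>G\<close> is the identity. The normalization makes
  the transported counit at the unit equal to \<open>\<epsilon>\<close>, and makes the spreading of a comodule restrict
  to that comodule.
\<close>

locale normalized_cofree_coring =
  fixes G :: "('g, 'w) monoid_scheme"
    and A :: "('a, 'z) ring_scheme"
    and C :: "('g, 'a, 'c) group_coring"
    and g :: "'g \<Rightarrow> 'c \<Rightarrow> 'c"
  assumes G: "group G" and A: "ring A" and C: "is_group_coring G A C"
    and g_iso: "\<alpha> \<in> carrier G \<Longrightarrow> g \<alpha> \<in> bimodule_isos A (gcobase C \<one>\<^bsub>G\<^esub>) (gcobase C \<alpha>)"
    and g_comult: "\<lbrakk>\<alpha> \<in> carrier G; \<beta> \<in> carrier G; c \<in> carrier (gcobase C \<one>\<^bsub>G\<^esub>)\<rbrakk> \<Longrightarrow>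
      gcomult C \<alpha> \<beta> (g (\<alpha> \<otimes>\<^bsub>G\<^esub> \<beta>) c) =
      tensor_map A (gcobase C \<one>\<^bsub>G\<^esub>) (gcobase C \<one>\<^bsub>G\<^esub>) (gcobase C \<alpha>) (gcobase C \<beta>) (g \<alpha>) (g \<beta>)
        (gcomult C \<one>\<^bsub>G\<^esub> \<one>\<^bsub>G\<^esub> c)"
    and g_one: "c \<in> carrier (gcobase C \<one>\<^bsub>G\<^esub>) \<Longrightarrow> g \<one>\<^bsub>G\<^esub> c = c"
begin

sublocale G: group G by (rule G)

abbreviation B where "B \<equiv> gcobase C"
abbreviation unit_base ("B\<^sub>1") where "unit_base \<equiv> gcobase C \<one>\<^bsub>G\<^esub>"
abbreviation \<Delta> where "\<Delta> \<equiv> gcomult C"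
abbreviation \<epsilon> where "\<epsilon> \<equiv> gcounit C"

lemma base_bimodule: "\<alpha> \<in> carrier G \<Longrightarrow> is_bimodule A (B \<alpha>)"
  and comult_bimodule_map: "\<alpha> \<in> carrier G \<Longrightarrow> \<beta> \<in> carrier G \<Longrightarrow>
    \<Delta> \<alpha> \<beta> \<in> bimodule_maps A (B (\<alpha> \<otimes>\<^bsub>G\<^esub> \<beta>)) (bimodule_tensor A (B \<alpha>) (B \<beta>))"
  and counit_bimodule_map: "\<epsilon> \<in> bimodule_maps A B\<^sub>1 (regular_bimodule A)"
  using C by (auto simp: is_group_coring_def Let_def)

lemma base_right_module: "\<alpha> \<in> carrier G \<Longrightarrow> is_right_module A (B \<alpha>)"
  by (rule is_bimoduleD(1)[OF base_bimodule])

lemma comult_in_tensor: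
  "\<lbrakk>\<alpha> \<in> carrier G; \<beta> \<in> carrier G; c \<in> carrier (B (\<alpha> \<otimes>\<^bsub>G\<^esub> \<beta>))\<rbrakk> \<Longrightarrow>
    \<Delta> \<alpha> \<beta> c \<in> carrier (tensor_group A (B \<alpha>) (B \<beta>))"
  using right_linear_mapsD(2)[OF bimodule_mapsD(1)[OF comult_bimodule_map]] by simp

definition g_inv where "g_inv \<alpha> = inv_into (carrier B\<^sub>1) (g \<alpha>)"

lemma g_bimodule_map: "\<alpha> \<in> carrier G \<Longrightarrow> g \<alpha> \<in> bimodule_maps A B\<^sub>1 (B \<alpha>)"
  using g_iso by (simp add: bimodule_isos_def)

lemma g_inv_bimodule_map: "\<alpha> \<in> carrier G \<Longrightarrow> g_inv \<alpha> \<in> bimodule_maps A (B \<alpha>) B\<^sub>1"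
  using bimodule_isos_inv[OF base_bimodule[OF G.one_closed] g_iso]
  by (simp add: bimodule_isos_def g_inv_def)

lemma g_inv_closed: "\<alpha> \<in> carrier G \<Longrightarrow> c \<in> carrier (B \<alpha>) \<Longrightarrow> g_inv \<alpha> c \<in> carrier B\<^sub>1"
  by (rule right_linear_mapsD(2)[OF bimodule_mapsD(1)[OF g_inv_bimodule_map]])

lemma g_g_inv: "\<alpha> \<in> carrier G \<Longrightarrow> c \<in> carrier (B \<alpha>) \<Longrightarrow> g \<alpha> (g_inv \<alpha> c) = c"
  using g_iso[of \<alpha>] unfolding g_inv_def bimodule_isos_def
  by (auto intro: bij_betw_inv_into_right)

lemma g_inv_g: "\<alpha> \<in> carrier G \<Longrightarrow> c \<in> carrier B\<^sub>1 \<Longrightarrow> g_inv \<alpha> (g \<alpha> c) = c"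
  using g_iso[of \<alpha>] unfolding g_inv_def bimodule_isos_def
  by (auto intro: bij_betw_inv_into_left)

lemma g_inv_one: "c \<in> carrier B\<^sub>1 \<Longrightarrow> g_inv \<one>\<^bsub>G\<^esub> c = c"
  using g_inv_g[OF G.one_closed] g_one by metis

text \<open>
  The comparison isomorphism \<open>B \<alpha> \<rightarrow> B \<beta>\<close> through \<open>B\<^sub>1\<close>, and the counit of \<open>B\<^sub>1\<close> carried over to
  \<open>B \<alpha>\<close>.
\<close>

definition shift where "shift \<alpha> \<beta> = g \<beta> \<circ> g_inv \<alpha>"

definition local_counit where "local_counit \<alpha> = \<epsilon> \<circ> g_inv \<alpha>"

lemma shift_bimodule_map:
  "\<alpha> \<in> carrier G \<Longrightarrow> \<beta> \<in> carrier G \<Longrightarrow> shift \<alpha> \<beta> \<in> bimodule_maps A (B \<alpha>) (B \<beta>)"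
  unfolding shift_def by (rule bimodule_maps_comp[OF g_inv_bimodule_map g_bimodule_map])

lemma local_counit_bimodule_map:
  "\<alpha> \<in> carrier G \<Longrightarrow> local_counit \<alpha> \<in> bimodule_maps A (B \<alpha>) (regular_bimodule A)"
  unfolding local_counit_def by (rule bimodule_maps_comp[OF g_inv_bimodule_map counit_bimodule_map])

lemma local_counit_shift:
  "\<lbrakk>\<alpha> \<in> carrier G; \<beta> \<in> carrier G; c \<in> carrier (B \<alpha>)\<rbrakk> \<Longrightarrow> local_counit \<beta> (shift \<alpha> \<beta> c) = local_counit \<alpha> c"
  by (simp add: shift_def local_counit_def g_inv_g g_inv_closed)

lemma counit_contraction:
  assumes c: "c \<in> carrier B\<^sub>1"
  shows "right_contraction A B\<^sub>1 B\<^sub>1 \<epsilon> (\<Delta> \<one>\<^bsub>G\<^esub> \<one>\<^bsub>G\<^esub> c) = c"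
    and "left_contraction A B\<^sub>1 B\<^sub>1 \<epsilon> (\<Delta> \<one>\<^bsub>G\<^esub> \<one>\<^bsub>G\<^esub> c) = c"
proof -
  note b = base_bimodule[OF G.one_closed] and r = base_right_module[OF G.one_closed]
  have d: "\<Delta> \<one>\<^bsub>G\<^esub> \<one>\<^bsub>G\<^esub> c \<in> carrier (tensor_group A B\<^sub>1 B\<^sub>1)"
    using comult_in_tensor[of "\<one>\<^bsub>G\<^esub>" "\<one>\<^bsub>G\<^esub>" c] c by simp
  have u: "right_unitor A B\<^sub>1 (tensor_map A B\<^sub>1 B\<^sub>1 B\<^sub>1 (regular_bimodule A) id \<epsilon> (\<Delta> \<one>\<^bsub>G\<^esub> \<one>\<^bsub>G\<^esub> c)) = c"
      "left_unitor A B\<^sub>1 (tensor_map A B\<^sub>1 B\<^sub>1 (regular_bimodule A) B\<^sub>1 \<epsilon> id (\<Delta> \<one>\<^bsub>G\<^esub> \<one>\<^bsub>G\<^esub> c)) = c"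
    using C c G.one_closed unfolding is_group_coring_def Let_def by blast+
  show "right_contraction A B\<^sub>1 B\<^sub>1 \<epsilon> (\<Delta> \<one>\<^bsub>G\<^esub> \<one>\<^bsub>G\<^esub> c) = c"
    using right_unitor_tensor_map[OF A r b counit_bimodule_map d] u by simp
  show "left_contraction A B\<^sub>1 B\<^sub>1 \<epsilon> (\<Delta> \<one>\<^bsub>G\<^esub> \<one>\<^bsub>G\<^esub> c) = c"
    using left_unitor_tensor_map[OF A b b counit_bimodule_map d] u by simp
qed

text \<open>
  Up to the isomorphisms \<open>g\<close>, each \<open>\<Delta> \<alpha> \<beta>\<close> is the comultiplication of \<open>B\<^sub>1\<close> and each transported
  counit is \<open>\<epsilon>\<close>; these are the two counit laws of \<open>B\<^sub>1\<close> written on the other components.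
\<close>

lemma local_counit_comult:
  assumes ab: "\<alpha> \<in> carrier G" "\<beta> \<in> carrier G" and c: "c \<in> carrier (B (\<alpha> \<otimes>\<^bsub>G\<^esub> \<beta>))"
  shows "right_contraction A (B \<alpha>) (B \<beta>) (local_counit \<beta>) (\<Delta> \<alpha> \<beta> c) = shift (\<alpha> \<otimes>\<^bsub>G\<^esub> \<beta>) \<alpha> c"
    and "left_contraction A (B \<alpha>) (B \<beta>) (local_counit \<alpha>) (\<Delta> \<alpha> \<beta> c) = shift (\<alpha> \<otimes>\<^bsub>G\<^esub> \<beta>) \<beta> c"
proof -
  define d where "d = g_inv (\<alpha> \<otimes>\<^bsub>G\<^esub> \<beta>) c"
  have d: "d \<in> carrier B\<^sub>1" using g_inv_closed[OF _ c] ab by (simp add: d_def)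
  have cd: "c = g (\<alpha> \<otimes>\<^bsub>G\<^esub> \<beta>) d" using g_g_inv[OF _ c] ab by (simp add: d_def)
  let ?D = "\<Delta> \<one>\<^bsub>G\<^esub> \<one>\<^bsub>G\<^esub> d"
  have D: "?D \<in> carrier (tensor_group A B\<^sub>1 B\<^sub>1)"
    using comult_in_tensor[of "\<one>\<^bsub>G\<^esub>" "\<one>\<^bsub>G\<^esub>" d] d by simp
  have e: "\<Delta> \<alpha> \<beta> c = tensor_map A B\<^sub>1 B\<^sub>1 (B \<alpha>) (B \<beta>) (g \<alpha>) (g \<beta>) ?D"
    unfolding cd by (rule g_comult[OF ab d])
  note b = base_bimodule[OF G.one_closed] and r = base_right_module[OF G.one_closed]
  note bb = base_bimodule[OF ab(1)] base_bimodule[OF ab(2)]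
  note lc = local_counit_bimodule_map[OF ab(1)] local_counit_bimodule_map[OF ab(2)]
  note gm = g_bimodule_map[OF ab(1)] g_bimodule_map[OF ab(2)]
  have eq: "(local_counit \<gamma> \<circ> g \<gamma>) x = \<epsilon> x" if "\<gamma> \<in> carrier G" "x \<in> carrier B\<^sub>1" for \<gamma> x
    using that by (simp add: local_counit_def g_inv_g)
  show "right_contraction A (B \<alpha>) (B \<beta>) (local_counit \<beta>) (\<Delta> \<alpha> \<beta> c) = shift (\<alpha> \<otimes>\<^bsub>G\<^esub> \<beta>) \<alpha> c"
    using right_contraction_natural[OF r b is_bimoduleD(1)[OF bb(1)] bb(2) lc(2) bimodule_mapsD(1)[OF gm(1)] gm(2) D]
      right_contraction_cong[OF r b bimodule_maps_comp[OF gm(2) lc(2)] counit_bimodule_map eq[OF ab(2)] D]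
      counit_contraction(1)[OF d]
    by (simp add: e shift_def d_def comp_def)
  show "left_contraction A (B \<alpha>) (B \<beta>) (local_counit \<alpha>) (\<Delta> \<alpha> \<beta> c) = shift (\<alpha> \<otimes>\<^bsub>G\<^esub> \<beta>) \<beta> c"
    using left_contraction_natural[OF b b bb lc(1) gm(1) bimodule_mapsD(2)[OF gm(2)] D]
      left_contraction_cong[OF b b bimodule_maps_comp[OF gm(1) lc(1)] counit_bimodule_map eq[OF ab(1)] D]
      counit_contraction(2)[OF d]
    by (simp add: e shift_def d_def comp_def)
qed

text \<open>
  A map from the component of \<open>M\<close> at \<open>\<alpha> \<beta>\<close> to the one at \<open>\<alpha>\<close>. For a constant family spread out
  from a comodule over \<open>B\<^sub>1\<close> it is the identity, so it measures how far \<open>M\<close> is from being constant.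
\<close>

definition transport :: "('g, 'a, 'c, 'm) group_comodule \<Rightarrow> 'g \<Rightarrow> 'g \<Rightarrow> 'm \<Rightarrow> 'm" where
  "transport M \<alpha> \<beta> = right_contraction A (gcmod M \<alpha>) (B \<beta>) (local_counit \<beta>) \<circ> gcoact M \<alpha> \<beta>"

lemma group_comoduleD:
  assumes "is_group_comodule G A C M"
  shows "\<And>\<alpha>. \<alpha> \<in> carrier G \<Longrightarrow> is_right_module A (gcmod M \<alpha>)"
    and "\<And>\<alpha> \<beta>. \<alpha> \<in> carrier G \<Longrightarrow> \<beta> \<in> carrier G \<Longrightarrow>
      gcoact M \<alpha> \<beta> \<in> right_linear_maps A (gcmod M (\<alpha> \<otimes>\<^bsub>G\<^esub> \<beta>)) (right_tensor A (gcmod M \<alpha>) (B \<beta>))"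
    and "\<And>\<alpha> \<beta> \<gamma> m. \<lbrakk>\<alpha> \<in> carrier G; \<beta> \<in> carrier G; \<gamma> \<in> carrier G;
        m \<in> carrier (gcmod M (\<alpha> \<otimes>\<^bsub>G\<^esub> \<beta> \<otimes>\<^bsub>G\<^esub> \<gamma>))\<rbrakk> \<Longrightarrow>
      tensor_map A (gcmod M \<alpha>) (B (\<beta> \<otimes>\<^bsub>G\<^esub> \<gamma>)) (gcmod M \<alpha>) (bimodule_tensor A (B \<beta>) (B \<gamma>))
           id (\<Delta> \<beta> \<gamma>) (gcoact M \<alpha> (\<beta> \<otimes>\<^bsub>G\<^esub> \<gamma>) m) =
         associator A (gcmod M \<alpha>) (B \<beta>) (B \<gamma>)
           (tensor_map A (gcmod M (\<alpha> \<otimes>\<^bsub>G\<^esub> \<beta>)) (B \<gamma>) (right_tensor A (gcmod M \<alpha>) (B \<beta>)) (B \<gamma>)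
              (gcoact M \<alpha> \<beta>) id (gcoact M (\<alpha> \<otimes>\<^bsub>G\<^esub> \<beta>) \<gamma> m))"
    and "\<And>\<alpha> m. \<alpha> \<in> carrier G \<Longrightarrow> m \<in> carrier (gcmod M \<alpha>) \<Longrightarrow>
      right_unitor A (gcmod M \<alpha>)
           (tensor_map A (gcmod M \<alpha>) B\<^sub>1 (gcmod M \<alpha>) (regular_bimodule A) id \<epsilon>
              (gcoact M \<alpha> \<one>\<^bsub>G\<^esub> m)) = m"
  using assms by (simp_all add: is_group_comodule_def Let_def)

lemma gcoact_closed:
  assumes "is_group_comodule G A C M" "\<alpha> \<in> carrier G" "\<beta> \<in> carrier G" "m \<in> carrier (gcmod M (\<alpha> \<otimes>\<^bsub>G\<^esub> \<beta>))"
  shows "gcoact M \<alpha> \<beta> m \<in> carrier (tensor_group A (gcmod M \<alpha>) (B \<beta>))"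
  using right_linear_mapsD(2)[OF group_comoduleD(2)[OF assms(1-3)] assms(4)] by simp

lemma transport_linear:
  assumes M: "is_group_comodule G A C M" and ab: "\<alpha> \<in> carrier G" "\<beta> \<in> carrier G"
  shows "transport M \<alpha> \<beta> \<in> right_linear_maps A (gcmod M (\<alpha> \<otimes>\<^bsub>G\<^esub> \<beta>)) (gcmod M \<alpha>)"
  unfolding transport_def
  by (rule right_linear_comp[OF group_comoduleD(2)[OF M ab] right_contraction_linear[OF
        group_comoduleD(1)[OF M ab(1)] base_bimodule[OF ab(2)] local_counit_bimodule_map[OF ab(2)]]])

text \<open>
  Both identities come from the coassociativity law of \<open>M\<close>, an equation in \<open>M \<alpha> \<otimes> (B \<beta> \<otimes> B \<gamma>)\<close>. The
  transported counit is applied to the factor \<open>B \<beta>\<close> for the first and to \<open>B \<gamma>\<close> for the second. On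
  the side of the comultiplication it leaves a comparison map, by \<open>local_counit_comult\<close>; on the side of
  the iterated coaction it turns the inner or the outer coaction into a transport map.
\<close>

lemma
  assumes M: "is_group_comodule G A C M"
    and a: "\<alpha> \<in> carrier G" and b: "\<beta> \<in> carrier G" and c: "\<gamma> \<in> carrier G"
    and m: "m \<in> carrier (gcmod M (\<alpha> \<otimes>\<^bsub>G\<^esub> \<beta> \<otimes>\<^bsub>G\<^esub> \<gamma>))"
  shows shift_gcoact_left:
      "tensor_map A (gcmod M \<alpha>) (B (\<beta> \<otimes>\<^bsub>G\<^esub> \<gamma>)) (gcmod M \<alpha>) (B \<gamma>) id (shift (\<beta> \<otimes>\<^bsub>G\<^esub> \<gamma>) \<gamma>)
         (gcoact M \<alpha> (\<beta> \<otimes>\<^bsub>G\<^esub> \<gamma>) m) =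
       tensor_map A (gcmod M (\<alpha> \<otimes>\<^bsub>G\<^esub> \<beta>)) (B \<gamma>) (gcmod M \<alpha>) (B \<gamma>) (transport M \<alpha> \<beta>) id
         (gcoact M (\<alpha> \<otimes>\<^bsub>G\<^esub> \<beta>) \<gamma> m)" (is "?shift\<^sub>l = ?left")
    and shift_gcoact_right:
      "tensor_map A (gcmod M \<alpha>) (B (\<beta> \<otimes>\<^bsub>G\<^esub> \<gamma>)) (gcmod M \<alpha>) (B \<beta>) id (shift (\<beta> \<otimes>\<^bsub>G\<^esub> \<gamma>) \<beta>)
         (gcoact M \<alpha> (\<beta> \<otimes>\<^bsub>G\<^esub> \<gamma>) m) =
       gcoact M \<alpha> \<beta> (transport M (\<alpha> \<otimes>\<^bsub>G\<^esub> \<beta>) \<gamma> m)" (is "?shift\<^sub>r = ?right")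
proof -
  let ?Ma = "gcmod M \<alpha>" and ?Mab = "gcmod M (\<alpha> \<otimes>\<^bsub>G\<^esub> \<beta>)" and ?BB = "bimodule_tensor A (B \<beta>) (B \<gamma>)"
  let ?x = "gcoact M \<alpha> (\<beta> \<otimes>\<^bsub>G\<^esub> \<gamma>) m" and ?y = "gcoact M (\<alpha> \<otimes>\<^bsub>G\<^esub> \<beta>) \<gamma> m"
  have ab: "\<alpha> \<otimes>\<^bsub>G\<^esub> \<beta> \<in> carrier G" and bc: "\<beta> \<otimes>\<^bsub>G\<^esub> \<gamma> \<in> carrier G" using a b c by auto
  note Ma = group_comoduleD(1)[OF M a] and Mab = group_comoduleD(1)[OF M ab]
  note Bb = base_bimodule[OF b] and Bc = base_bimodule[OF c] and Bbc = base_bimodule[OF bc]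
  note BB = is_bimodule_tensor[OF A Bb Bc] and MB = is_right_module_tensor[OF A Ma Bb]
  note D = bimodule_mapsD(2)[OF comult_bimodule_map[OF b c]]
  note eb = local_counit_bimodule_map[OF b] and ec = local_counit_bimodule_map[OF c]
  note r = group_comoduleD(2)[OF M a b]
  have x: "?x \<in> carrier (tensor_group A ?Ma (B (\<beta> \<otimes>\<^bsub>G\<^esub> \<gamma>)))"
    using gcoact_closed[OF M a bc] m a b c by (simp add: G.m_assoc)
  have y: "?y \<in> carrier (tensor_group A ?Mab (B \<gamma>))" by (rule gcoact_closed[OF M ab c m])
  have z: "tensor_map A ?Mab (B \<gamma>) (right_tensor A ?Ma (B \<beta>)) (B \<gamma>) (gcoact M \<alpha> \<beta>) id ?y
      \<in> carrier (tensor_group A (right_tensor A ?Ma (B \<beta>)) (B \<gamma>))" (is "?z \<in> _")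
    by (rule hom_in_carrier[OF tensor_map_hom[OF Mab Bc MB Bc r id_linear(2)] y])
  note coassoc = group_comoduleD(3)[OF M a b c m]
  note L = left_contraction_linear[OF Bb Bc eb] and R = right_contraction_left_linear[OF Bb Bc ec]
  have "?shift\<^sub>l = tensor_map A ?Ma (B (\<beta> \<otimes>\<^bsub>G\<^esub> \<gamma>)) ?Ma (B \<gamma>) (id \<circ> id)
      (left_contraction A (B \<beta>) (B \<gamma>) (local_counit \<beta>) \<circ> \<Delta> \<beta> \<gamma>) ?x"
    using bimodule_mapsD(2)[OF shift_bimodule_map[OF bc c]]
    by (intro tensor_map_cong[OF Ma Bbc Ma Bc _ _ _ _ _ _ x] left_linear_comp[OF D L])
      (auto simp: local_counit_comult(2)[OF b c])
  also have "\<dots> = tensor_map A ?Ma ?BB ?Ma (B \<gamma>) id (left_contraction A (B \<beta>) (B \<gamma>) (local_counit \<beta>))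
      (tensor_map A ?Ma (B (\<beta> \<otimes>\<^bsub>G\<^esub> \<gamma>)) ?Ma ?BB id (\<Delta> \<beta> \<gamma>) ?x)"
    by (rule tensor_map_comp[OF Ma Bbc Ma BB Ma Bc id_linear(1) D id_linear(1) L x, symmetric])
  also have "\<dots> = tensor_map A (right_tensor A ?Ma (B \<beta>)) (B \<gamma>) ?Ma (B \<gamma>)
      (right_contraction A ?Ma (B \<beta>) (local_counit \<beta>)) id ?z"
    unfolding coassoc by (rule left_contraction_associator[OF A Ma Bb Bc eb z])
  also have "\<dots> = tensor_map A ?Mab (B \<gamma>) ?Ma (B \<gamma>)
      (right_contraction A ?Ma (B \<beta>) (local_counit \<beta>) \<circ> gcoact M \<alpha> \<beta>) (id \<circ> id) ?y"
    by (rule tensor_map_comp[OF Mab Bc MB Bc Ma Bc r id_linear(2)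
          right_contraction_linear[OF Ma Bb eb] id_linear(2) y])
  finally show "?shift\<^sub>l = ?left" by (simp add: transport_def)
  have "?shift\<^sub>r = tensor_map A ?Ma (B (\<beta> \<otimes>\<^bsub>G\<^esub> \<gamma>)) ?Ma (B \<beta>) (id \<circ> id)
      (right_contraction A (B \<beta>) (B \<gamma>) (local_counit \<gamma>) \<circ> \<Delta> \<beta> \<gamma>) ?x"
    using bimodule_mapsD(2)[OF shift_bimodule_map[OF bc b]]
    by (intro tensor_map_cong[OF Ma Bbc Ma Bb _ _ _ _ _ _ x] left_linear_comp[OF D R])
      (auto simp: local_counit_comult(1)[OF b c])
  also have "\<dots> = tensor_map A ?Ma ?BB ?Ma (B \<beta>) id (right_contraction A (B \<beta>) (B \<gamma>) (local_counit \<gamma>))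
      (tensor_map A ?Ma (B (\<beta> \<otimes>\<^bsub>G\<^esub> \<gamma>)) ?Ma ?BB id (\<Delta> \<beta> \<gamma>) ?x)"
    by (rule tensor_map_comp[OF Ma Bbc Ma BB Ma Bb id_linear(1) D id_linear(1) R x, symmetric])
  also have "\<dots> = right_contraction A (right_tensor A ?Ma (B \<beta>)) (B \<gamma>) (local_counit \<gamma>) ?z"
    unfolding coassoc by (rule right_contraction_associator[OF A Ma Bb Bc ec z])
  also have "\<dots> = gcoact M \<alpha> \<beta> (right_contraction A ?Mab (B \<gamma>) (local_counit \<gamma> \<circ> id) ?y)"
    by (rule right_contraction_natural[OF Mab Bc MB Bc ec r id_linear(3) y])
  finally show "?shift\<^sub>r = ?right" by (simp add: transport_def)
qed

text \<open>
  Contract both sides of \<open>shift_gcoact_right\<close> with the transported counit of \<open>B \<beta>\<close>, which the comparison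
  map pulls back to that of \<open>B (\<beta> \<gamma>)\<close>.
\<close>

lemma transport_transport:
  assumes M: "is_group_comodule G A C M"
    and a: "\<alpha> \<in> carrier G" and b: "\<beta> \<in> carrier G" and c: "\<gamma> \<in> carrier G"
    and m: "m \<in> carrier (gcmod M (\<alpha> \<otimes>\<^bsub>G\<^esub> \<beta> \<otimes>\<^bsub>G\<^esub> \<gamma>))"
  shows "transport M \<alpha> \<beta> (transport M (\<alpha> \<otimes>\<^bsub>G\<^esub> \<beta>) \<gamma> m) = transport M \<alpha> (\<beta> \<otimes>\<^bsub>G\<^esub> \<gamma>) m"
proof -
  have bc: "\<beta> \<otimes>\<^bsub>G\<^esub> \<gamma> \<in> carrier G" using b c by auto
  note Ma = group_comoduleD(1)[OF M a]
  note Bb = base_bimodule[OF b] and Bbc = base_bimodule[OF bc]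
  note s = shift_bimodule_map[OF bc b] and eb = local_counit_bimodule_map[OF b]
  have x: "gcoact M \<alpha> (\<beta> \<otimes>\<^bsub>G\<^esub> \<gamma>) m \<in> carrier (tensor_group A (gcmod M \<alpha>) (B (\<beta> \<otimes>\<^bsub>G\<^esub> \<gamma>)))"
    using gcoact_closed[OF M a bc] m a b c by (simp add: G.m_assoc)
  have "transport M \<alpha> \<beta> (transport M (\<alpha> \<otimes>\<^bsub>G\<^esub> \<beta>) \<gamma> m) =
      right_contraction A (gcmod M \<alpha>) (B \<beta>) (local_counit \<beta>)
        (tensor_map A (gcmod M \<alpha>) (B (\<beta> \<otimes>\<^bsub>G\<^esub> \<gamma>)) (gcmod M \<alpha>) (B \<beta>) id (shift (\<beta> \<otimes>\<^bsub>G\<^esub> \<gamma>) \<beta>)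
         (gcoact M \<alpha> (\<beta> \<otimes>\<^bsub>G\<^esub> \<gamma>) m))"
    unfolding shift_gcoact_right[OF assms] by (simp add: transport_def[of M \<alpha> \<beta>])
  also have "\<dots> = right_contraction A (gcmod M \<alpha>) (B (\<beta> \<otimes>\<^bsub>G\<^esub> \<gamma>)) (local_counit \<beta> \<circ> shift (\<beta> \<otimes>\<^bsub>G\<^esub> \<gamma>) \<beta>)
      (gcoact M \<alpha> (\<beta> \<otimes>\<^bsub>G\<^esub> \<gamma>) m)"
    using right_contraction_natural[OF Ma Bbc Ma Bb eb id_linear(1) s x] by simp
  also have "\<dots> = right_contraction A (gcmod M \<alpha>) (B (\<beta> \<otimes>\<^bsub>G\<^esub> \<gamma>)) (local_counit (\<beta> \<otimes>\<^bsub>G\<^esub> \<gamma>))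
      (gcoact M \<alpha> (\<beta> \<otimes>\<^bsub>G\<^esub> \<gamma>) m)"
    by (rule right_contraction_cong[OF Ma Bbc bimodule_maps_comp[OF s eb] local_counit_bimodule_map[OF bc] _ x])
      (simp add: local_counit_shift[OF bc b])
  finally show ?thesis by (simp add: transport_def)
qed

lemma transport_one:
  assumes M: "is_group_comodule G A C M" and a: "\<alpha> \<in> carrier G" and m: "m \<in> carrier (gcmod M \<alpha>)"
  shows "transport M \<alpha> \<one>\<^bsub>G\<^esub> m = m"
proof -
  note Ma = group_comoduleD(1)[OF M a] and B1 = base_bimodule[OF G.one_closed]
  have x: "gcoact M \<alpha> \<one>\<^bsub>G\<^esub> m \<in> carrier (tensor_group A (gcmod M \<alpha>) B\<^sub>1)"
    using gcoact_closed[OF M a G.one_closed] m a by simp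
  have "transport M \<alpha> \<one>\<^bsub>G\<^esub> m = right_contraction A (gcmod M \<alpha>) B\<^sub>1 \<epsilon> (gcoact M \<alpha> \<one>\<^bsub>G\<^esub> m)"
    unfolding transport_def comp_def
    by (rule right_contraction_cong[OF Ma B1 local_counit_bimodule_map[OF G.one_closed] counit_bimodule_map _ x])
      (simp add: local_counit_def g_inv_one)
  then show ?thesis
    using right_unitor_tensor_map[OF A Ma B1 counit_bimodule_map x] group_comoduleD(4)[OF M a m] by simp
qed

lemma transport_inverse:
  assumes M: "is_group_comodule G A C M" and a: "\<alpha> \<in> carrier G"
  shows "m \<in> carrier (gcmod M \<one>\<^bsub>G\<^esub>) \<Longrightarrow> transport M \<one>\<^bsub>G\<^esub> \<alpha> (transport M \<alpha> (inv\<^bsub>G\<^esub> \<alpha>) m) = m"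
    and "m' \<in> carrier (gcmod M \<alpha>) \<Longrightarrow> transport M \<alpha> (inv\<^bsub>G\<^esub> \<alpha>) (transport M \<one>\<^bsub>G\<^esub> \<alpha> m') = m'"
  using transport_transport[OF M G.one_closed a G.inv_closed[OF a], of m]
    transport_transport[OF M a G.inv_closed[OF a] a, of m'] a
    transport_one[OF M G.one_closed, of m] transport_one[OF M a, of m']
  by simp_all

lemma transport_natural:
  assumes M: "is_group_comodule G A C M" and N: "is_group_comodule G A C N"
    and f: "f \<in> group_comodule_maps G A C M N" and a: "\<alpha> \<in> carrier G" and b: "\<beta> \<in> carrier G"
    and m: "m \<in> carrier (gcmod M (\<alpha> \<otimes>\<^bsub>G\<^esub> \<beta>))"
  shows "transport N \<alpha> \<beta> (f (\<alpha> \<otimes>\<^bsub>G\<^esub> \<beta>) m) = f \<alpha> (transport M \<alpha> \<beta> m)"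
proof -
  have fa: "f \<alpha> \<in> right_linear_maps A (gcmod M \<alpha>) (gcmod N \<alpha>)"
    and fc: "gcoact N \<alpha> \<beta> (f (\<alpha> \<otimes>\<^bsub>G\<^esub> \<beta>) m) =
      tensor_map A (gcmod M \<alpha>) (B \<beta>) (gcmod N \<alpha>) (B \<beta>) (f \<alpha>) id (gcoact M \<alpha> \<beta> m)"
    using f a b m by (auto simp: group_comodule_maps_def PiE_def Pi_def)
  show ?thesis
    using right_contraction_natural[OF group_comoduleD(1)[OF M a] base_bimodule[OF b]
        group_comoduleD(1)[OF N a] base_bimodule[OF b] local_counit_bimodule_map[OF b] fa
        id_linear(3) gcoact_closed[OF M a b m]]
    by (simp add: transport_def fc)
qed

end

section \<open>The categories of comodules\<close>

lemma restrict_right_linear: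
  assumes "is_right_module A M" "f \<in> right_linear_maps A M N"
  shows "restrict f (carrier M) \<in> right_linear_maps A M N"
  by (rule right_linear_cong[OF assms]) simp

lemma compose_right_linear:
  assumes "is_right_module A M" "f \<in> right_linear_maps A M N" "g \<in> right_linear_maps A N P"
  shows "compose (carrier M) g f \<in> right_linear_maps A M P"
  using restrict_right_linear[OF assms(1) right_linear_comp[OF assms(2,3)]]
  by (simp add: compose_def comp_def)

text \<open>
  The morphisms of the comodule categories are extensional, so identities and composites there are
  restrictions of the usual ones; \<open>tensor_map\<close> ignores the values off the carrier.
\<close>

lemma tensor_map_restrict_id:
  assumes M: "is_right_module A M" and C: "is_bimodule A C" and t: "t \<in> carrier (tensor_group A M C)"
  shows "tensor_map A M C M C (\<lambda>m\<in>carrier M. m) id t = t"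
  using restrict_right_linear[OF M id_linear(1)]
  by (intro tensor_map_id[OF M C _ id_linear(2) _ _ t]) (auto simp: id_def)

lemma tensor_map_compose:
  assumes M: "is_right_module A M" and N: "is_right_module A N" and P: "is_right_module A P"
    and C: "is_bimodule A C"
    and f: "f \<in> right_linear_maps A M N" and g: "g \<in> right_linear_maps A N P"
    and t: "t \<in> carrier (tensor_group A M C)"
  shows "tensor_map A M C P C (compose (carrier M) g f) id t =
    tensor_map A N C P C g id (tensor_map A M C N C f id t)"
  unfolding tensor_map_comp[OF M C N C P C f id_linear(2) g id_linear(2) t]
  by (rule tensor_map_cong[OF M C P C compose_right_linear[OF M f g] right_linear_comp[OF f g] _ _ _ _ t])
     (auto simp: compose_def)

lemma comodule_category_simps [simp]:
  "Obj (comodule_category A D) = {M. is_comodule A D M}"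
  "Hom (comodule_category A D) = comodule_maps A D"
  "Ident (comodule_category A D) = (\<lambda>M. \<lambda>m\<in>carrier (cmod M). m)"
  "Comp (comodule_category A D) = (\<lambda>M N P g f. compose (carrier (cmod M)) g f)"
  by (simp_all add: comodule_category_def)

lemma group_comodule_category_simps [simp]:
  "Obj (group_comodule_category G A C) = {M. is_group_comodule G A C M}"
  "Hom (group_comodule_category G A C) = group_comodule_maps G A C"
  "Ident (group_comodule_category G A C) = (\<lambda>M. \<lambda>\<alpha>\<in>carrier G. \<lambda>m\<in>carrier (gcmod M \<alpha>). m)"
  "Comp (group_comodule_category G A C) =
     (\<lambda>M N P g f. \<lambda>\<alpha>\<in>carrier G. compose (carrier (gcmod M \<alpha>)) (g \<alpha>) (f \<alpha>))"
  by (simp_all add: group_comodule_category_def)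

lemma comoduleD:
  assumes "is_comodule A D M"
  shows "is_right_module A (cmod M)"
    and "coact M \<in> right_linear_maps A (cmod M) (right_tensor A (cmod M) (cobase D))"
    and "\<And>m. m \<in> carrier (cmod M) \<Longrightarrow>
      tensor_map A (cmod M) (cobase D) (cmod M) (bimodule_tensor A (cobase D) (cobase D)) id (comult D)
        (coact M m) =
      associator A (cmod M) (cobase D) (cobase D)
        (tensor_map A (cmod M) (cobase D) (right_tensor A (cmod M) (cobase D)) (cobase D) (coact M) id
          (coact M m))"
    and "\<And>m. m \<in> carrier (cmod M) \<Longrightarrow>
      right_unitor A (cmod M)
        (tensor_map A (cmod M) (cobase D) (cmod M) (regular_bimodule A) id (counit D) (coact M m)) = m"
    and "\<And>m. m \<in> carrier (cmod M) \<Longrightarrow> coact M m \<in> carrier (tensor_group A (cmod M) (cobase D))"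
proof -
  show r: "coact M \<in> right_linear_maps A (cmod M) (right_tensor A (cmod M) (cobase D))"
    using assms by (simp add: is_comodule_def Let_def)
  show "coact M m \<in> carrier (tensor_group A (cmod M) (cobase D))" if "m \<in> carrier (cmod M)" for m
    using right_linear_mapsD(2)[OF r that] by simp
qed (use assms in \<open>simp_all add: is_comodule_def Let_def\<close>)

lemma comodule_maps_iff:
  "f \<in> comodule_maps A D M N \<longleftrightarrow>
    f \<in> right_linear_maps A (cmod M) (cmod N) \<and> f \<in> extensional (carrier (cmod M)) \<and>
    (\<forall>m\<in>carrier (cmod M).
      tensor_map A (cmod M) (cobase D) (cmod N) (cobase D) f id (coact M m) = coact N (f m))"
  by (simp add: comodule_maps_def)

lemma group_comodule_maps_iff:
  "f \<in> group_comodule_maps G A C M N \<longleftrightarrow>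
    f \<in> extensional (carrier G) \<and>
    (\<forall>\<alpha>\<in>carrier G. f \<alpha> \<in> right_linear_maps A (gcmod M \<alpha>) (gcmod N \<alpha>) \<and>
      f \<alpha> \<in> extensional (carrier (gcmod M \<alpha>))) \<and>
    (\<forall>\<alpha>\<in>carrier G. \<forall>\<beta>\<in>carrier G. \<forall>m\<in>carrier (gcmod M (\<alpha> \<otimes>\<^bsub>G\<^esub> \<beta>)).
          tensor_map A (gcmod M \<alpha>) (gcobase C \<beta>) (gcmod N \<alpha>) (gcobase C \<beta>)
            (f \<alpha>) id (gcoact M \<alpha> \<beta> m) =
          gcoact N \<alpha> \<beta> (f (\<alpha> \<otimes>\<^bsub>G\<^esub> \<beta>) m))"
  by (auto simp: group_comodule_maps_def PiE_def Pi_def)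

lemma compose_restrict_id:
  "f \<in> extensional S \<Longrightarrow> compose S f (\<lambda>x\<in>S. x) = f"
  "f \<in> extensional S \<Longrightarrow> f \<in> S \<rightarrow> T \<Longrightarrow> compose S (\<lambda>x\<in>T. x) f = f"
  by (auto simp: compose_def extensional_def fun_eq_iff)

lemma compose_compose: "f \<in> S \<rightarrow> T \<Longrightarrow> compose S h (compose S g f) = compose S (compose T h g) f"
  by (auto simp: compose_def fun_eq_iff)

lemma is_category_comodule:
  assumes D: "is_bimodule A (cobase D)"
  shows "is_category (comodule_category A D)"
proof -
  have 1: "(\<lambda>m\<in>carrier (cmod M). m) \<in> comodule_maps A D M M" if M: "is_comodule A D M" for M
    using restrict_right_linear[OF comoduleD(1)[OF M] id_linear(1)]
    by (auto simp: comodule_maps_iff id_def tensor_map_restrict_id[OF comoduleD(1)[OF M] D comoduleD(5)[OF M], unfolded id_def])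
  have 2: "compose (carrier (cmod M)) g f \<in> comodule_maps A D M P"
    if M: "is_comodule A D M" and N: "is_comodule A D N" and P: "is_comodule A D P"
      and f: "f \<in> comodule_maps A D M N" and g: "g \<in> comodule_maps A D N P" for M N P f g
    using f g compose_right_linear[OF comoduleD(1)[OF M]]
    by (auto simp: comodule_maps_iff compose_eq right_linear_mapsD
      tensor_map_compose[OF comoduleD(1)[OF M] comoduleD(1)[OF N] comoduleD(1)[OF P] D _ _ comoduleD(5)[OF M]])
  have f: "f \<in> extensional (carrier (cmod M))" "f \<in> carrier (cmod M) \<rightarrow> carrier (cmod N)"
    if "f \<in> comodule_maps A D M N" for f M N
    using that by (auto simp: comodule_maps_iff right_linear_mapsD)
  show ?thesis
    unfolding is_category_def
    by (auto simp: 1 2 compose_restrict_id[OF f(1)] compose_restrict_id(2)[OF f] compose_compose[OF f(2)])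
qed

lemma is_category_group_comodule:
  assumes G: "group G" and B: "\<And>\<alpha>. \<alpha> \<in> carrier G \<Longrightarrow> is_bimodule A (gcobase C \<alpha>)"
  shows "is_category (group_comodule_category G A C)"
proof -
  interpret group G by fact
  have N: "is_right_module A (gcmod M \<alpha>)" if "is_group_comodule G A C M" "\<alpha> \<in> carrier G" for M \<alpha>
    using that by (simp add: is_group_comodule_def Let_def)
  have r: "gcoact M \<alpha> \<beta> m \<in> carrier (tensor_group A (gcmod M \<alpha>) (gcobase C \<beta>))"
    if "is_group_comodule G A C M" "\<alpha> \<in> carrier G" "\<beta> \<in> carrier G" "m \<in> carrier (gcmod M (\<alpha> \<otimes>\<^bsub>G\<^esub> \<beta>))"
    for M \<alpha> \<beta> m
  proof -
    have "gcoact M \<alpha> \<beta>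
        \<in> right_linear_maps A (gcmod M (\<alpha> \<otimes>\<^bsub>G\<^esub> \<beta>)) (right_tensor A (gcmod M \<alpha>) (gcobase C \<beta>))"
      using that(1-3) by (simp add: is_group_comodule_def Let_def)
    from right_linear_mapsD(2)[OF this that(4)] show ?thesis by simp
  qed
  have 1: "(\<lambda>\<alpha>\<in>carrier G. \<lambda>m\<in>carrier (gcmod M \<alpha>). m) \<in> group_comodule_maps G A C M M"
    if M: "is_group_comodule G A C M" for M
    using restrict_right_linear[OF N[OF M] id_linear(1)]
    by (auto simp: group_comodule_maps_iff id_def tensor_map_restrict_id[OF N[OF M] B r[OF M], unfolded id_def])
  have 2: "(\<lambda>\<alpha>\<in>carrier G. compose (carrier (gcmod M \<alpha>)) (g \<alpha>) (f \<alpha>)) \<in> group_comodule_maps G A C M P"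
    if M: "is_group_comodule G A C M" and M': "is_group_comodule G A C M'" and P: "is_group_comodule G A C P"
      and f: "f \<in> group_comodule_maps G A C M M'" and g: "g \<in> group_comodule_maps G A C M' P" for M M' P f g
  proof -
    have fl: "\<alpha> \<in> carrier G \<Longrightarrow> f \<alpha> \<in> right_linear_maps A (gcmod M \<alpha>) (gcmod M' \<alpha>)"
      and gl: "\<alpha> \<in> carrier G \<Longrightarrow> g \<alpha> \<in> right_linear_maps A (gcmod M' \<alpha>) (gcmod P \<alpha>)" for \<alpha>
      using f g by (simp_all add: group_comodule_maps_iff)
    show ?thesis
      using f g
      by (auto simp: group_comodule_maps_iff compose_eq right_linear_mapsD(2)[OF fl]
          compose_right_linear[OF N[OF M] fl gl]
          tensor_map_compose[OF N[OF M] N[OF M'] N[OF P] B fl gl r[OF M]])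
  qed
  have f: "f \<in> extensional (carrier G)"
    "\<alpha> \<in> carrier G \<Longrightarrow> f \<alpha> \<in> extensional (carrier (gcmod M \<alpha>))"
    "\<alpha> \<in> carrier G \<Longrightarrow> f \<alpha> \<in> carrier (gcmod M \<alpha>) \<rightarrow> carrier (gcmod N \<alpha>)"
    if "f \<in> group_comodule_maps G A C M N" for f M N \<alpha>
    using that by (auto simp: group_comodule_maps_iff right_linear_mapsD)
  have 3: "(\<lambda>\<alpha>\<in>carrier G. compose (carrier (gcmod M \<alpha>)) (f \<alpha>)
        (\<lambda>m\<in>carrier (gcmod M \<alpha>). m)) = f"
    "(\<lambda>\<alpha>\<in>carrier G. compose (carrier (gcmod M \<alpha>))
        (\<lambda>m\<in>carrier (gcmod N \<alpha>). m) (f \<alpha>)) = f"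
    if "f \<in> group_comodule_maps G A C M N" for f M N
    using f[OF that]
    by (auto simp: compose_restrict_id(1)[OF f(2)[OF that]] compose_restrict_id(2)[OF f(2,3)[OF that]]
      intro!: extensionalityI[of _ "carrier G"])
  show ?thesis
    unfolding is_category_def
    by (auto simp: 1 2 3 compose_compose[OF f(3)] cong: restrict_cong)
qed

section \<open>The equivalence\<close>

context normalized_cofree_coring
begin

text \<open>
  The two functors on objects: the constant family with the coaction moved along \<open>g\<close>, and the
  component at the unit of \<open>G\<close>.
\<close>

definition spread :: "('a, 'c, 'm) comodule \<Rightarrow> ('g, 'a, 'c, 'm) group_comodule" where
  "spread M = \<lparr>gcmod = (\<lambda>\<alpha>. cmod M),
     gcoact = (\<lambda>\<alpha> \<beta> m. tensor_map A (cmod M) B\<^sub>1 (cmod M) (B \<beta>) id (g \<beta>) (coact M m))\<rparr>"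

definition unit_part :: "('g, 'a, 'c, 'm) group_comodule \<Rightarrow> ('a, 'c, 'm) comodule" where
  "unit_part M = \<lparr>cmod = gcmod M \<one>\<^bsub>G\<^esub>, coact = gcoact M \<one>\<^bsub>G\<^esub> \<one>\<^bsub>G\<^esub>\<rparr>"

lemma spread_simps [simp]:
  "gcmod (spread M) \<alpha> = cmod M"
  "gcoact (spread M) \<alpha> \<beta> = (\<lambda>m. tensor_map A (cmod M) B\<^sub>1 (cmod M) (B \<beta>) id (g \<beta>) (coact M m))"
  by (simp_all add: spread_def)

lemma unit_part_simps [simp]:
  "cmod (unit_part M) = gcmod M \<one>\<^bsub>G\<^esub>"
  "coact (unit_part M) = gcoact M \<one>\<^bsub>G\<^esub> \<one>\<^bsub>G\<^esub>"
  by (simp_all add: unit_part_def)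

lemma unit_coring_simps [simp]:
  "cobase (unit_coring G C) = B\<^sub>1"
  "comult (unit_coring G C) = \<Delta> \<one>\<^bsub>G\<^esub> \<one>\<^bsub>G\<^esub>"
  "counit (unit_coring G C) = \<epsilon>"
  by (simp_all add: unit_coring_def)

lemma unit_part_comodule:
  assumes "is_group_comodule G A C M"
  shows "is_comodule A (unit_coring G C) (unit_part M)"
  using group_comoduleD(1,4)[OF assms G.one_closed] group_comoduleD(2)[OF assms G.one_closed G.one_closed]
    group_comoduleD(3)[OF assms G.one_closed G.one_closed G.one_closed]
  by (simp add: is_comodule_def Let_def)

text \<open>
  Moving both coring factors of the coassociativity law of \<open>M\<close> along \<open>g\<close> gives the law for the constant
  family: on one side \<open>g\<close> is compatible with the comultiplications, on the other the associator is natural.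
\<close>

lemma spread_comodule:
  assumes M: "is_comodule A (unit_coring G C) M"
  shows "is_group_comodule G A C (spread M)"
proof -
  let ?M = "cmod M" and ?r = "coact M" and ?R = "gcoact (spread M)"
  note B1 = base_bimodule[OF G.one_closed]
  note m = comoduleD(1)[OF M]
  note MD = comoduleD[OF M, simplified]
  note D1 = comult_bimodule_map[OF G.one_closed G.one_closed, simplified]
  have tg: "tensor_map A ?M B\<^sub>1 ?M (B \<beta>) id (g \<beta>)
      \<in> right_linear_maps A (right_tensor A ?M B\<^sub>1) (right_tensor A ?M (B \<beta>))" if "\<beta> \<in> carrier G" for \<beta>
    by (rule tensor_map_right_linear[OF m B1 m base_bimodule[OF that] id_linear(1) g_bimodule_map[OF that]])
  have R: "?R \<alpha> \<beta> \<in> right_linear_maps A ?M (right_tensor A ?M (B \<beta>))" if "\<beta> \<in> carrier G" for \<alpha> \<beta>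
    using right_linear_comp[OF MD(2) tg[OF that]] by (simp add: comp_def)
  have coassoc: "tensor_map A ?M (B (\<beta> \<otimes>\<^bsub>G\<^esub> \<gamma>)) ?M (bimodule_tensor A (B \<beta>) (B \<gamma>)) id (\<Delta> \<beta> \<gamma>)
        (?R \<alpha> (\<beta> \<otimes>\<^bsub>G\<^esub> \<gamma>) x) =
      associator A ?M (B \<beta>) (B \<gamma>) (tensor_map A ?M (B \<gamma>) (right_tensor A ?M (B \<beta>)) (B \<gamma>)
        (?R \<alpha> \<beta>) id (?R (\<alpha> \<otimes>\<^bsub>G\<^esub> \<beta>) \<gamma> x))"
    if b: "\<beta> \<in> carrier G" and c: "\<gamma> \<in> carrier G" and x: "x \<in> carrier ?M" for \<alpha> \<beta> \<gamma> x
  proof -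
    have bc: "\<beta> \<otimes>\<^bsub>G\<^esub> \<gamma> \<in> carrier G" using b c by simp
    note Bb = base_bimodule[OF b] and Bc = base_bimodule[OF c] and Bbc = base_bimodule[OF bc]
    note r1 = base_right_module[OF G.one_closed]
    note BB = is_bimodule_tensor[OF A Bb Bc] and BB1 = is_bimodule_tensor[OF A B1 B1]
    note MB = is_right_module_tensor[OF A m Bb] and MB1 = is_right_module_tensor[OF A m B1]
    note D = bimodule_mapsD(2)[OF comult_bimodule_map[OF b c]]
    note gb = g_bimodule_map[OF b] and gc = g_bimodule_map[OF c] and gbc = g_bimodule_map[OF bc]
    note gg = tensor_map_bimodule[OF B1 B1 Bb Bc gb gc]
    have rx: "?r x \<in> carrier (tensor_group A ?M B\<^sub>1)" by (rule MD(5)[OF x])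
    have z: "tensor_map A ?M B\<^sub>1 (right_tensor A ?M B\<^sub>1) B\<^sub>1 ?r id (?r x)
        \<in> carrier (tensor_group A (right_tensor A ?M B\<^sub>1) B\<^sub>1)"
      by (rule hom_in_carrier[OF tensor_map_hom[OF m B1 MB1 B1 MD(2) id_linear(2)] rx])
    have "tensor_map A ?M (B (\<beta> \<otimes>\<^bsub>G\<^esub> \<gamma>)) ?M (bimodule_tensor A (B \<beta>) (B \<gamma>)) id (\<Delta> \<beta> \<gamma>)
        (?R \<alpha> (\<beta> \<otimes>\<^bsub>G\<^esub> \<gamma>) x) =
      tensor_map A ?M B\<^sub>1 ?M (bimodule_tensor A (B \<beta>) (B \<gamma>)) (id \<circ> id) (\<Delta> \<beta> \<gamma> \<circ> g (\<beta> \<otimes>\<^bsub>G\<^esub> \<gamma>)) (?r x)"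
      using tensor_map_comp[OF m B1 m Bbc m BB id_linear(1) bimodule_mapsD(2)[OF gbc] id_linear(1) D rx]
      by simp
    also have "\<dots> = tensor_map A ?M B\<^sub>1 ?M (bimodule_tensor A (B \<beta>) (B \<gamma>)) (id \<circ> id)
        (tensor_map A B\<^sub>1 B\<^sub>1 (B \<beta>) (B \<gamma>) (g \<beta>) (g \<gamma>) \<circ> \<Delta> \<one>\<^bsub>G\<^esub> \<one>\<^bsub>G\<^esub>) (?r x)"
      by (rule tensor_map_cong[OF m B1 m BB _ _ left_linear_comp[OF bimodule_mapsD(2)[OF gbc] D]
            left_linear_comp[OF bimodule_mapsD(2)[OF D1] bimodule_mapsD(2)[OF gg]] _ _ rx])
        (simp_all add: g_comult[OF b c])
    also have "\<dots> = tensor_map A ?M (bimodule_tensor A B\<^sub>1 B\<^sub>1) ?M (bimodule_tensor A (B \<beta>) (B \<gamma>)) id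
        (tensor_map A B\<^sub>1 B\<^sub>1 (B \<beta>) (B \<gamma>) (g \<beta>) (g \<gamma>))
        (tensor_map A ?M B\<^sub>1 ?M (bimodule_tensor A B\<^sub>1 B\<^sub>1) id (\<Delta> \<one>\<^bsub>G\<^esub> \<one>\<^bsub>G\<^esub>) (?r x))"
      by (rule tensor_map_comp[OF m B1 m BB1 m BB id_linear(1) bimodule_mapsD(2)[OF D1] id_linear(1)
            bimodule_mapsD(2)[OF gg] rx, symmetric])
    also have "\<dots> = associator A ?M (B \<beta>) (B \<gamma>)
        (tensor_map A (right_tensor A ?M B\<^sub>1) B\<^sub>1 (right_tensor A ?M (B \<beta>)) (B \<gamma>)
          (tensor_map A ?M B\<^sub>1 ?M (B \<beta>) id (g \<beta>)) (g \<gamma>)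
          (tensor_map A ?M B\<^sub>1 (right_tensor A ?M B\<^sub>1) B\<^sub>1 ?r id (?r x)))"
      unfolding MD(3)[OF x]
      by (rule associator_natural[OF A m B1 B1 m Bb Bc id_linear(1) gb gc z, symmetric])
    also have "tensor_map A (right_tensor A ?M B\<^sub>1) B\<^sub>1 (right_tensor A ?M (B \<beta>)) (B \<gamma>)
          (tensor_map A ?M B\<^sub>1 ?M (B \<beta>) id (g \<beta>)) (g \<gamma>)
          (tensor_map A ?M B\<^sub>1 (right_tensor A ?M B\<^sub>1) B\<^sub>1 ?r id (?r x)) =
        tensor_map A ?M B\<^sub>1 (right_tensor A ?M (B \<beta>)) (B \<gamma>) (?R \<alpha> \<beta> \<circ> id) (id \<circ> g \<gamma>) (?r x)"
      using tensor_map_comp[OF m B1 MB1 B1 MB Bc MD(2) id_linear(2) tg[OF b] bimodule_mapsD(2)[OF gc] rx]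
      by (simp add: comp_def)
    also have "\<dots> = tensor_map A ?M (B \<gamma>) (right_tensor A ?M (B \<beta>)) (B \<gamma>) (?R \<alpha> \<beta>) id
        (?R (\<alpha> \<otimes>\<^bsub>G\<^esub> \<beta>) \<gamma> x)"
      using tensor_map_comp[OF m B1 m Bc MB Bc id_linear(1) bimodule_mapsD(2)[OF gc] R[OF b] id_linear(2) rx]
      by simp
    finally show ?thesis .
  qed
  have counit: "right_unitor A ?M (tensor_map A ?M B\<^sub>1 ?M (regular_bimodule A) id \<epsilon> (?R \<alpha> \<one>\<^bsub>G\<^esub> x)) = x"
    if x: "x \<in> carrier ?M" for \<alpha> x
  proof -
    have rx: "?r x \<in> carrier (tensor_group A ?M B\<^sub>1)" by (rule MD(5)[OF x])
    have "?R \<alpha> \<one>\<^bsub>G\<^esub> x = ?r x"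
      using tensor_map_id[OF m B1 id_linear(1) bimodule_mapsD(2)[OF g_bimodule_map[OF G.one_closed]] _ g_one rx]
      by simp
    then show ?thesis using MD(4)[OF x] by simp
  qed
  show ?thesis
    unfolding is_group_comodule_def Let_def
    using m R coassoc counit by simp
qed

lemma spread_maps:
  assumes M: "is_comodule A (unit_coring G C) M" and N: "is_comodule A (unit_coring G C) N"
    and f: "f \<in> comodule_maps A (unit_coring G C) M N"
  shows "(\<lambda>\<alpha>\<in>carrier G. f) \<in> group_comodule_maps G A C (spread M) (spread N)"
proof -
  note m = comoduleD(1)[OF M] and n = comoduleD(1)[OF N] and B1 = base_bimodule[OF G.one_closed]
  note F = f[unfolded comodule_maps_iff, simplified]
  have "tensor_map A (cmod M) (B \<beta>) (cmod N) (B \<beta>) f id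
      (tensor_map A (cmod M) B\<^sub>1 (cmod M) (B \<beta>) id (g \<beta>) (coact M x)) =
    tensor_map A (cmod N) B\<^sub>1 (cmod N) (B \<beta>) id (g \<beta>) (coact N (f x))"
    if b: "\<beta> \<in> carrier G" and x: "x \<in> carrier (cmod M)" for \<beta> x
  proof -
    note Bb = base_bimodule[OF b] and gb = bimodule_mapsD(2)[OF g_bimodule_map[OF b]]
    note rx = comoduleD(5)[OF M x, simplified]
    show ?thesis
      using tensor_map_comp[OF m B1 m Bb n Bb id_linear(1) gb conjunct1[OF F] id_linear(2) rx]
        tensor_map_comp[OF m B1 n B1 n Bb conjunct1[OF F] id_linear(2) id_linear(1) gb rx] F x
      by simp
  qed
  then show ?thesis using F by (simp add: group_comodule_maps_iff)
qed

lemma unit_part_maps: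
  assumes "f \<in> group_comodule_maps G A C M N"
  shows "f \<one>\<^bsub>G\<^esub> \<in> comodule_maps A (unit_coring G C) (unit_part M) (unit_part N)"
proof -
  have "tensor_map A (gcmod M \<one>\<^bsub>G\<^esub>) B\<^sub>1 (gcmod N \<one>\<^bsub>G\<^esub>) B\<^sub>1 (f \<one>\<^bsub>G\<^esub>) id (gcoact M \<one>\<^bsub>G\<^esub> \<one>\<^bsub>G\<^esub> m) =
      gcoact N \<one>\<^bsub>G\<^esub> \<one>\<^bsub>G\<^esub> (f (\<one>\<^bsub>G\<^esub> \<otimes>\<^bsub>G\<^esub> \<one>\<^bsub>G\<^esub>) m)"
    if "m \<in> carrier (gcmod M (\<one>\<^bsub>G\<^esub> \<otimes>\<^bsub>G\<^esub> \<one>\<^bsub>G\<^esub>))" for m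
    using assms that G.one_closed unfolding group_comodule_maps_iff by blast
  then show ?thesis
    using assms by (simp add: group_comodule_maps_iff comodule_maps_iff)
qed

definition spread_functor ::
  "(('a, 'c, 'm) comodule, 'm \<Rightarrow> 'm, ('g, 'a, 'c, 'm) group_comodule, 'g \<Rightarrow> 'm \<Rightarrow> 'm) cat_functor" where
  "spread_functor = \<lparr>fobj = spread, farr = (\<lambda>M N f. \<lambda>\<alpha>\<in>carrier G. f)\<rparr>"

definition unit_part_functor ::
  "(('g, 'a, 'c, 'm) group_comodule, 'g \<Rightarrow> 'm \<Rightarrow> 'm, ('a, 'c, 'm) comodule, 'm \<Rightarrow> 'm) cat_functor" where
  "unit_part_functor = \<lparr>fobj = unit_part, farr = (\<lambda>M N f. f \<one>\<^bsub>G\<^esub>)\<rparr>"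

lemma is_functor_spread:
  "is_functor (comodule_category A (unit_coring G C)) (group_comodule_category G A C) spread_functor"
  by (auto simp: is_functor_def spread_functor_def spread_comodule spread_maps cong: restrict_cong)

lemma is_functor_unit_part:
  "is_functor (group_comodule_category G A C) (comodule_category A (unit_coring G C)) unit_part_functor"
  by (auto simp: is_functor_def unit_part_functor_def unit_part_comodule unit_part_maps)

text \<open>
  The coaction of \<open>unit_part (spread M)\<close> agrees with that of \<open>M\<close> only on the carrier, so the two comodules
  need not be equal as records; the identity is an isomorphism between them.
\<close>

lemma unit_part_spread:
  assumes M: "is_comodule A (unit_coring G C) M"
  shows "(\<lambda>m\<in>carrier (cmod M). m) \<in> comodule_maps A (unit_coring G C) M (unit_part (spread M))"
    and "(\<lambda>m\<in>carrier (cmod M). m) \<in> comodule_maps A (unit_coring G C) (unit_part (spread M)) M"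
proof -
  note m = comoduleD(1)[OF M] and B1 = base_bimodule[OF G.one_closed]
  have i: "(\<lambda>m\<in>carrier (cmod M). m) \<in> right_linear_maps A (cmod M) (cmod M)"
    using restrict_right_linear[OF m id_linear(1)] by (simp add: id_def)
  have r: "gcoact (spread M) \<one>\<^bsub>G\<^esub> \<one>\<^bsub>G\<^esub> x = coact M x" if "x \<in> carrier (cmod M)" for x
    using tensor_map_id[OF m B1 id_linear(1) bimodule_mapsD(2)[OF g_bimodule_map[OF G.one_closed]] _ g_one]
      comoduleD(5)[OF M that] by simp
  have t: "tensor_map A (cmod M) B\<^sub>1 (cmod M) B\<^sub>1 (\<lambda>m\<in>carrier (cmod M). m) id (coact M x) = coact M x"
    if "x \<in> carrier (cmod M)" for x
    using tensor_map_restrict_id[OF m B1] comoduleD(5)[OF M that] by simp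
  show "(\<lambda>m\<in>carrier (cmod M). m) \<in> comodule_maps A (unit_coring G C) M (unit_part (spread M))"
    and "(\<lambda>m\<in>carrier (cmod M). m) \<in> comodule_maps A (unit_coring G C) (unit_part (spread M)) M"
    using i r t by (simp_all add: comodule_maps_iff del: spread_simps(2))
qed

text \<open>
  The isomorphism between the constant family on the component of \<open>M\<close> at the unit and \<open>M\<close> itself, and its
  inverse.
\<close>

definition from_unit where
  "from_unit M = (\<lambda>\<alpha>\<in>carrier G. \<lambda>m\<in>carrier (gcmod M \<one>\<^bsub>G\<^esub>). transport M \<alpha> (inv\<^bsub>G\<^esub> \<alpha>) m)"

definition to_unit where
  "to_unit M = (\<lambda>\<alpha>\<in>carrier G. \<lambda>m\<in>carrier (gcmod M \<alpha>). transport M \<one>\<^bsub>G\<^esub> \<alpha> m)"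

lemma
  assumes M: "is_group_comodule G A C M" and a: "\<alpha> \<in> carrier G"
  shows transport_from_unit: "transport M \<alpha> (inv\<^bsub>G\<^esub> \<alpha>) \<in> right_linear_maps A (gcmod M \<one>\<^bsub>G\<^esub>) (gcmod M \<alpha>)"
    and transport_to_unit: "transport M \<one>\<^bsub>G\<^esub> \<alpha> \<in> right_linear_maps A (gcmod M \<alpha>) (gcmod M \<one>\<^bsub>G\<^esub>)"
  using transport_linear[OF M a, of "inv\<^bsub>G\<^esub> \<alpha>"] transport_linear[OF M _ a, of "\<one>\<^bsub>G\<^esub>"] a by simp_all

text \<open>
  After the comparison maps are collected, both sides of the comodule condition are the coaction
  \<open>M \<one> \<rightarrow> M \<alpha> \<otimes> B (\<alpha>\<^sup>-\<^sup>1)\<close> followed by the comparison map \<open>B (\<alpha>\<^sup>-\<^sup>1) \<rightarrow> B \<beta>\<close>: one side by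
  \<open>shift_gcoact_left\<close> for \<open>\<one> = \<alpha> \<alpha>\<^sup>-\<^sup>1 \<one>\<close>, the other by \<open>shift_gcoact_right\<close> for
  \<open>\<one> = \<alpha> \<beta> (\<alpha> \<beta>)\<^sup>-\<^sup>1\<close>.
\<close>

lemma from_unit_map:
  assumes M: "is_group_comodule G A C M"
  shows "from_unit M \<in> group_comodule_maps G A C (spread (unit_part M)) M"
proof -
  let ?U = "gcmod M \<one>\<^bsub>G\<^esub>" and ?r = "gcoact M \<one>\<^bsub>G\<^esub> \<one>\<^bsub>G\<^esub>"
  note u = group_comoduleD(1)[OF M G.one_closed] and B1 = base_bimodule[OF G.one_closed]
  have "tensor_map A ?U (B \<beta>) (gcmod M \<alpha>) (B \<beta>) (restrict (transport M \<alpha> (inv\<^bsub>G\<^esub> \<alpha>)) (carrier ?U)) id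
      (tensor_map A ?U B\<^sub>1 ?U (B \<beta>) id (g \<beta>) (?r x)) =
    gcoact M \<alpha> \<beta> (transport M (\<alpha> \<otimes>\<^bsub>G\<^esub> \<beta>) (inv\<^bsub>G\<^esub> (\<alpha> \<otimes>\<^bsub>G\<^esub> \<beta>)) x)"
    if a: "\<alpha> \<in> carrier G" and b: "\<beta> \<in> carrier G" and x: "x \<in> carrier ?U" for \<alpha> \<beta> x
  proof -
    have ia: "inv\<^bsub>G\<^esub> \<alpha> \<in> carrier G" and iab: "inv\<^bsub>G\<^esub> (\<alpha> \<otimes>\<^bsub>G\<^esub> \<beta>) \<in> carrier G" using a b by auto
    note Ma = group_comoduleD(1)[OF M a]
    note Bb = base_bimodule[OF b] and Bia = base_bimodule[OF ia]
    note gb = bimodule_mapsD(2)[OF g_bimodule_map[OF b]]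
    note t = transport_from_unit[OF M a] and tr = restrict_right_linear[OF u transport_from_unit[OF M a]]
    have rx: "?r x \<in> carrier (tensor_group A ?U B\<^sub>1)"
      using gcoact_closed[OF M G.one_closed G.one_closed, of x] x by simp
    let ?y = "gcoact M \<alpha> (inv\<^bsub>G\<^esub> \<alpha>) x"
    have y: "?y \<in> carrier (tensor_group A (gcmod M \<alpha>) (B (inv\<^bsub>G\<^esub> \<alpha>)))"
      using gcoact_closed[OF M a ia, of x] x a by simp
    have "tensor_map A ?U (B \<beta>) (gcmod M \<alpha>) (B \<beta>) (restrict (transport M \<alpha> (inv\<^bsub>G\<^esub> \<alpha>)) (carrier ?U)) id
        (tensor_map A ?U B\<^sub>1 ?U (B \<beta>) id (g \<beta>) (?r x)) =
      tensor_map A ?U B\<^sub>1 (gcmod M \<alpha>) (B \<beta>) (restrict (transport M \<alpha> (inv\<^bsub>G\<^esub> \<alpha>)) (carrier ?U)) (g \<beta>) (?r x)"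
      using tensor_map_comp[OF u B1 u Bb Ma Bb id_linear(1) gb tr id_linear(2) rx] by simp
    also have "\<dots> = tensor_map A ?U B\<^sub>1 (gcmod M \<alpha>) (B \<beta>) (transport M \<alpha> (inv\<^bsub>G\<^esub> \<alpha>)) (g \<beta>) (?r x)"
      by (rule tensor_map_cong[OF u B1 Ma Bb tr t gb gb _ _ rx]) auto
    also have "\<dots> = tensor_map A (gcmod M \<alpha>) B\<^sub>1 (gcmod M \<alpha>) (B \<beta>) id (g \<beta>)
        (tensor_map A ?U B\<^sub>1 (gcmod M \<alpha>) B\<^sub>1 (transport M \<alpha> (inv\<^bsub>G\<^esub> \<alpha>)) id (?r x))"
      using tensor_map_comp[OF u B1 Ma B1 Ma Bb t id_linear(2) id_linear(1) gb rx] by simp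
    also have "tensor_map A ?U B\<^sub>1 (gcmod M \<alpha>) B\<^sub>1 (transport M \<alpha> (inv\<^bsub>G\<^esub> \<alpha>)) id (?r x) =
        tensor_map A (gcmod M \<alpha>) (B (inv\<^bsub>G\<^esub> \<alpha>)) (gcmod M \<alpha>) B\<^sub>1 id (shift (inv\<^bsub>G\<^esub> \<alpha>) \<one>\<^bsub>G\<^esub>) ?y"
      using shift_gcoact_left[OF M a ia G.one_closed, of x] x a by simp
    also have "tensor_map A (gcmod M \<alpha>) B\<^sub>1 (gcmod M \<alpha>) (B \<beta>) id (g \<beta>) \<dots> =
        tensor_map A (gcmod M \<alpha>) (B (inv\<^bsub>G\<^esub> \<alpha>)) (gcmod M \<alpha>) (B \<beta>) id (g \<beta> \<circ> shift (inv\<^bsub>G\<^esub> \<alpha>) \<one>\<^bsub>G\<^esub>) ?y"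
      using tensor_map_comp[OF Ma Bia Ma B1 Ma Bb id_linear(1)
          bimodule_mapsD(2)[OF shift_bimodule_map[OF ia G.one_closed]] id_linear(1) gb y] by simp
    also have "\<dots> = tensor_map A (gcmod M \<alpha>) (B (inv\<^bsub>G\<^esub> \<alpha>)) (gcmod M \<alpha>) (B \<beta>) id (shift (inv\<^bsub>G\<^esub> \<alpha>) \<beta>) ?y"
      by (rule tensor_map_cong[OF Ma Bia Ma Bb _ _ left_linear_comp[OF
            bimodule_mapsD(2)[OF shift_bimodule_map[OF ia G.one_closed]] gb]
            bimodule_mapsD(2)[OF shift_bimodule_map[OF ia b]] _ _ y])
        (auto simp: shift_def g_one g_inv_closed[OF ia])
    also have "\<dots> = gcoact M \<alpha> \<beta> (transport M (\<alpha> \<otimes>\<^bsub>G\<^esub> \<beta>) (inv\<^bsub>G\<^esub> (\<alpha> \<otimes>\<^bsub>G\<^esub> \<beta>)) x)"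
    proof -
      have "\<beta> \<otimes>\<^bsub>G\<^esub> inv\<^bsub>G\<^esub> (\<alpha> \<otimes>\<^bsub>G\<^esub> \<beta>) = inv\<^bsub>G\<^esub> \<alpha>"
        using a b by (simp add: G.inv_mult_group G.m_assoc[symmetric])
      then show ?thesis using shift_gcoact_right[OF M a b iab, of x] x a b by simp
    qed
    finally show ?thesis .
  qed
  then show ?thesis
    using restrict_right_linear[OF u transport_from_unit[OF M]]
    by (simp add: group_comodule_maps_iff from_unit_def)
qed

text \<open>
  Here both sides are the coaction \<open>M (\<alpha> \<beta>) \<rightarrow> M \<one> \<otimes> B (\<alpha> \<beta>)\<close> followed by the comparison map
  \<open>B (\<alpha> \<beta>) \<rightarrow> B \<beta>\<close>.
\<close>

lemma to_unit_map:
  assumes M: "is_group_comodule G A C M"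
  shows "to_unit M \<in> group_comodule_maps G A C M (spread (unit_part M))"
proof -
  let ?U = "gcmod M \<one>\<^bsub>G\<^esub>" and ?r = "gcoact M \<one>\<^bsub>G\<^esub> \<one>\<^bsub>G\<^esub>"
  note u = group_comoduleD(1)[OF M G.one_closed] and B1 = base_bimodule[OF G.one_closed]
  have "tensor_map A (gcmod M \<alpha>) (B \<beta>) ?U (B \<beta>) (restrict (transport M \<one>\<^bsub>G\<^esub> \<alpha>) (carrier (gcmod M \<alpha>))) id
      (gcoact M \<alpha> \<beta> x) =
    tensor_map A ?U B\<^sub>1 ?U (B \<beta>) id (g \<beta>) (?r (transport M \<one>\<^bsub>G\<^esub> (\<alpha> \<otimes>\<^bsub>G\<^esub> \<beta>) x))"
    if a: "\<alpha> \<in> carrier G" and b: "\<beta> \<in> carrier G" and x: "x \<in> carrier (gcmod M (\<alpha> \<otimes>\<^bsub>G\<^esub> \<beta>))" for \<alpha> \<beta> x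
  proof -
    have ab: "\<alpha> \<otimes>\<^bsub>G\<^esub> \<beta> \<in> carrier G" using a b by auto
    note Ma = group_comoduleD(1)[OF M a]
    note Bb = base_bimodule[OF b] and Bab = base_bimodule[OF ab]
    note gb = bimodule_mapsD(2)[OF g_bimodule_map[OF b]]
    note t = transport_to_unit[OF M a]
    let ?y = "gcoact M \<one>\<^bsub>G\<^esub> (\<alpha> \<otimes>\<^bsub>G\<^esub> \<beta>) x"
    have y: "?y \<in> carrier (tensor_group A ?U (B (\<alpha> \<otimes>\<^bsub>G\<^esub> \<beta>)))"
      using gcoact_closed[OF M G.one_closed ab, of x] x ab by simp
    have "tensor_map A (gcmod M \<alpha>) (B \<beta>) ?U (B \<beta>) (restrict (transport M \<one>\<^bsub>G\<^esub> \<alpha>) (carrier (gcmod M \<alpha>))) id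
        (gcoact M \<alpha> \<beta> x) =
      tensor_map A (gcmod M \<alpha>) (B \<beta>) ?U (B \<beta>) (transport M \<one>\<^bsub>G\<^esub> \<alpha>) id (gcoact M \<alpha> \<beta> x)"
      by (rule tensor_map_cong[OF Ma Bb u Bb restrict_right_linear[OF Ma t] t id_linear(2) id_linear(2)
            _ _ gcoact_closed[OF M a b x]]) auto
    also have "\<dots> = tensor_map A ?U (B (\<alpha> \<otimes>\<^bsub>G\<^esub> \<beta>)) ?U (B \<beta>) id (shift (\<alpha> \<otimes>\<^bsub>G\<^esub> \<beta>) \<beta>) ?y"
      using shift_gcoact_left[OF M G.one_closed a b, of x] x a b by simp
    also have "\<dots> = tensor_map A ?U (B (\<alpha> \<otimes>\<^bsub>G\<^esub> \<beta>)) ?U (B \<beta>) id (g \<beta> \<circ> shift (\<alpha> \<otimes>\<^bsub>G\<^esub> \<beta>) \<one>\<^bsub>G\<^esub>) ?y"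
      by (rule tensor_map_cong[OF u Bab u Bb _ _ bimodule_mapsD(2)[OF shift_bimodule_map[OF ab b]]
            left_linear_comp[OF bimodule_mapsD(2)[OF shift_bimodule_map[OF ab G.one_closed]] gb] _ _ y])
        (auto simp: shift_def g_one g_inv_closed[OF ab])
    also have "\<dots> = tensor_map A ?U B\<^sub>1 ?U (B \<beta>) id (g \<beta>)
        (tensor_map A ?U (B (\<alpha> \<otimes>\<^bsub>G\<^esub> \<beta>)) ?U B\<^sub>1 id (shift (\<alpha> \<otimes>\<^bsub>G\<^esub> \<beta>) \<one>\<^bsub>G\<^esub>) ?y)"
      using tensor_map_comp[OF u Bab u B1 u Bb id_linear(1)
          bimodule_mapsD(2)[OF shift_bimodule_map[OF ab G.one_closed]] id_linear(1) gb y] by simp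
    also have "tensor_map A ?U (B (\<alpha> \<otimes>\<^bsub>G\<^esub> \<beta>)) ?U B\<^sub>1 id (shift (\<alpha> \<otimes>\<^bsub>G\<^esub> \<beta>) \<one>\<^bsub>G\<^esub>) ?y =
        ?r (transport M \<one>\<^bsub>G\<^esub> (\<alpha> \<otimes>\<^bsub>G\<^esub> \<beta>) x)"
      using shift_gcoact_right[OF M G.one_closed G.one_closed ab, of x] x ab by simp
    finally show ?thesis .
  qed
  then show ?thesis
    using restrict_right_linear[OF group_comoduleD(1)[OF M] transport_to_unit[OF M]]
    by (simp add: group_comodule_maps_iff to_unit_def)
qed

lemma from_unit_iso:
  assumes M: "is_group_comodule G A C M"
  shows "is_iso_arrow (group_comodule_category G A C) (spread (unit_part M)) M (from_unit M)"
proof -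
  have 1: "compose (carrier (gcmod M \<one>\<^bsub>G\<^esub>)) (to_unit M \<alpha>) (from_unit M \<alpha>) = (\<lambda>m\<in>carrier (gcmod M \<one>\<^bsub>G\<^esub>). m)"
    and 2: "compose (carrier (gcmod M \<alpha>)) (from_unit M \<alpha>) (to_unit M \<alpha>) = (\<lambda>m\<in>carrier (gcmod M \<alpha>). m)"
    if a: "\<alpha> \<in> carrier G" for \<alpha>
    using a transport_inverse[OF M a] right_linear_mapsD(2)[OF transport_from_unit[OF M a]]
      right_linear_mapsD(2)[OF transport_to_unit[OF M a]]
    by (auto simp: compose_def from_unit_def to_unit_def fun_eq_iff)
  show ?thesis
    unfolding is_iso_arrow_def
    using from_unit_map[OF M] to_unit_map[OF M]
    by (auto simp: 1 2 intro!: bexI[of _ "to_unit M"] cong: restrict_cong)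
qed

lemma from_unit_natural:
  assumes M: "is_group_comodule G A C M" and N: "is_group_comodule G A C N"
    and f: "f \<in> group_comodule_maps G A C M N" and a: "\<alpha> \<in> carrier G"
  shows "compose (carrier (gcmod M \<one>\<^bsub>G\<^esub>)) (from_unit N \<alpha>) (f \<one>\<^bsub>G\<^esub>) =
    compose (carrier (gcmod M \<one>\<^bsub>G\<^esub>)) (f \<alpha>) (from_unit M \<alpha>)"
proof -
  have f1: "f \<one>\<^bsub>G\<^esub> m \<in> carrier (gcmod N \<one>\<^bsub>G\<^esub>)" if "m \<in> carrier (gcmod M \<one>\<^bsub>G\<^esub>)" for m
  proof (rule right_linear_mapsD(2)[OF _ that])
    show "f \<one>\<^bsub>G\<^esub> \<in> right_linear_maps A (gcmod M \<one>\<^bsub>G\<^esub>) (gcmod N \<one>\<^bsub>G\<^esub>)"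
      using f by (simp add: group_comodule_maps_iff)
  qed
  show ?thesis
    using transport_natural[OF M N f a G.inv_closed[OF a]] a f1
    by (auto simp: compose_def from_unit_def fun_eq_iff)
qed

theorem equivalent_comodule_categories:
  "equivalent_categories
     (comodule_category A (unit_coring G C) :: (('a, 'c, 'm) comodule, 'm \<Rightarrow> 'm) category)
     (group_comodule_category G A C :: (('g, 'a, 'c, 'm) group_comodule, 'g \<Rightarrow> 'm \<Rightarrow> 'm) category)"
  (is "equivalent_categories ?\<C> ?\<D>")
proof -
  have \<C>: "is_category ?\<C>"
    by (rule is_category_comodule) (simp add: base_bimodule)
  have \<D>: "is_category ?\<D>"
    by (rule is_category_group_comodule[OF G base_bimodule])
  have \<eta>: "is_natural_iso ?\<C> ?\<C> id_functor (comp_functor unit_part_functor spread_functor)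
      (\<lambda>M. \<lambda>m\<in>carrier (cmod M). m)"
  proof -
    have "is_iso_arrow ?\<C> M (unit_part (spread M)) (\<lambda>m\<in>carrier (cmod M). m)"
      if "is_comodule A (unit_coring G C) M" for M
      unfolding is_iso_arrow_def using unit_part_spread[OF that]
      by (auto intro!: bexI[of _ "\<lambda>m\<in>carrier (cmod M). m"] simp: compose_restrict_id(1))
    moreover have "compose (carrier (cmod M)) (\<lambda>m\<in>carrier (cmod N). m) f =
        compose (carrier (cmod M)) f (\<lambda>m\<in>carrier (cmod M). m)"
      if "f \<in> comodule_maps A (unit_coring G C) M N" for f M N
      using that by (auto simp: comodule_maps_iff compose_restrict_id right_linear_mapsD(2) Pi_def)
    ultimately show ?thesis
      unfolding is_natural_iso_def id_functor_def comp_functor_def unit_part_functor_def spread_functor_def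
      by simp blast
  qed
  have \<theta>: "is_natural_iso ?\<D> ?\<D> (comp_functor spread_functor unit_part_functor) id_functor from_unit"
    by (auto simp: is_natural_iso_def id_functor_def comp_functor_def unit_part_functor_def
        spread_functor_def intro!: restrict_ext from_unit_natural from_unit_iso)
  show ?thesis
    unfolding equivalent_categories_def
    using \<C> \<D> is_functor_spread is_functor_unit_part \<eta> \<theta> by blast
qed

end

text \<open>
  The component \<open>\<gamma> \<one>\<close> of a cofree structure is an automorphism of \<open>B \<one>\<close> that respects the
  comultiplication, and so is its inverse \<open>d\<close>. Composing every component with \<open>d\<close> therefore keeps
  the compatibility with the comultiplications and turns the component at \<open>\<one>\<close> into the identity.
\<close>

lemma cofree_normalized:
  assumes G: "group G" and A: "ring A" and C: "is_group_coring G A C" and "cofree G A C"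
  shows "\<exists>g. normalized_cofree_coring G A C g"
proof -
  interpret group G by fact
  let ?B = "gcobase C" and ?D = "gcomult C \<one>\<^bsub>G\<^esub> \<one>\<^bsub>G\<^esub>" and ?B1 = "gcobase C \<one>\<^bsub>G\<^esub>"
  obtain \<gamma> where iso: "\<And>\<alpha>. \<alpha> \<in> carrier G \<Longrightarrow> \<gamma> \<alpha> \<in> bimodule_isos A ?B1 (?B \<alpha>)"
    and comult: "\<And>\<alpha> \<beta> c. \<lbrakk>\<alpha> \<in> carrier G; \<beta> \<in> carrier G; c \<in> carrier ?B1\<rbrakk> \<Longrightarrow>
      gcomult C \<alpha> \<beta> (\<gamma> (\<alpha> \<otimes>\<^bsub>G\<^esub> \<beta>) c) = tensor_map A ?B1 ?B1 (?B \<alpha>) (?B \<beta>) (\<gamma> \<alpha>) (\<gamma> \<beta>) (?D c)"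
    using \<open>cofree G A C\<close> unfolding cofree_def Let_def by blast
  have B: "is_bimodule A (?B \<alpha>)" if "\<alpha> \<in> carrier G" for \<alpha>
    using C that by (simp add: is_group_coring_def Let_def)
  have Dc: "?D c \<in> carrier (tensor_group A ?B1 ?B1)" if "c \<in> carrier ?B1" for c
  proof -
    have "?D \<in> bimodule_maps A (?B (\<one>\<^bsub>G\<^esub> \<otimes>\<^bsub>G\<^esub> \<one>\<^bsub>G\<^esub>)) (bimodule_tensor A ?B1 ?B1)"
      using C one_closed unfolding is_group_coring_def Let_def by blast
    then show ?thesis using right_linear_mapsD(2)[OF bimodule_mapsD(1)] that by force
  qed
  define d where "d = inv_into (carrier ?B1) (\<gamma> \<one>\<^bsub>G\<^esub>)"
  have d: "d \<in> bimodule_isos A ?B1 ?B1"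
    unfolding d_def by (rule bimodule_isos_inv[OF B iso]) auto
  have bij: "bij_betw (\<gamma> \<one>\<^bsub>G\<^esub>) (carrier ?B1) (carrier ?B1)"
    using iso[OF one_closed] by (simp add: bimodule_isos_def)
  have dc: "d c \<in> carrier ?B1" if "c \<in> carrier ?B1" for c
    using d that by (auto simp: bimodule_isos_def bij_betw_def)
  have d1: "\<gamma> \<one>\<^bsub>G\<^esub> (d c) = c" if "c \<in> carrier ?B1" for c
    using bij_betw_inv_into_right[OF bij that] by (simp add: d_def)
  have g: "\<gamma> \<alpha> \<circ> d \<in> bimodule_isos A ?B1 (?B \<alpha>)" if "\<alpha> \<in> carrier G" for \<alpha>
    by (rule bimodule_isos_comp[OF d iso[OF that]])
  have map: "f \<in> right_linear_maps A M N" "f \<in> left_linear_maps A M N" if "f \<in> bimodule_isos A M N" for f M N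
    using that by (auto simp: bimodule_isos_def bimodule_maps_iff)
  note B1 = B[OF one_closed]
  note r1 = is_bimoduleD(1)[OF B1]
  have "gcomult C \<alpha> \<beta> ((\<gamma> (\<alpha> \<otimes>\<^bsub>G\<^esub> \<beta>) \<circ> d) c) =
      tensor_map A ?B1 ?B1 (?B \<alpha>) (?B \<beta>) (\<gamma> \<alpha> \<circ> d) (\<gamma> \<beta> \<circ> d) (?D c)"
    if a: "\<alpha> \<in> carrier G" and b: "\<beta> \<in> carrier G" and c: "c \<in> carrier ?B1" for \<alpha> \<beta> c
  proof -
    note ra = is_bimoduleD(1)[OF B[OF a]]
    note ga = map(1)[OF iso[OF a]] and gb = map(2)[OF iso[OF b]]
    note g1 = map[OF iso[OF one_closed]] and dm = map[OF d]
    have D1: "?D c = tensor_map A ?B1 ?B1 ?B1 ?B1 (\<gamma> \<one>\<^bsub>G\<^esub>) (\<gamma> \<one>\<^bsub>G\<^esub>) (?D (d c))"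
      using comult[OF one_closed one_closed dc[OF c]] d1[OF c] by simp
    \<comment> \<open>The next two steps say that \<open>d\<close> respects the comultiplication of the unit component.\<close>
    have "tensor_map A ?B1 ?B1 ?B1 ?B1 d d (?D c) = tensor_map A ?B1 ?B1 ?B1 ?B1 (d \<circ> \<gamma> \<one>\<^bsub>G\<^esub>) (d \<circ> \<gamma> \<one>\<^bsub>G\<^esub>) (?D (d c))"
      unfolding D1 by (rule tensor_map_comp[OF r1 B1 r1 B1 r1 B1 g1 dm Dc[OF dc[OF c]]])
    also have "\<dots> = ?D (d c)"
      using bij_betw_inv_into_left[OF bij]
      by (intro tensor_map_id[OF r1 B1 right_linear_comp[OF g1(1) dm(1)] left_linear_comp[OF g1(2) dm(2)]
            _ _ Dc[OF dc[OF c]]]) (auto simp: d_def)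
    finally show ?thesis
      using tensor_map_comp[OF r1 B1 r1 B1 ra B[OF b] dm ga gb Dc[OF c]] comult[OF a b dc[OF c]] by simp
  qed
  then have "normalized_cofree_coring G A C (\<lambda>\<alpha>. \<gamma> \<alpha> \<circ> d)"
    using G A C g d1 by (intro normalized_cofree_coring.intro) simp_all
  then show ?thesis by blast
qed

theorem theorem2p2:
  fixes G :: "('g, 'w) monoid_scheme"
    and A :: "('a, 'z) ring_scheme"
    and C :: "('g, 'a, 'c) group_coring"
  assumes "group G"
    and "ring A"
    and "is_group_coring G A C"
    and "cofree G A C"
  shows "equivalent_categories
           (comodule_category A (unit_coring G C) :: (('a, 'c, 'm) comodule, 'm \<Rightarrow> 'm) category)
           (group_comodule_category G A C ::
              (('g, 'a, 'c, 'm) group_comodule, 'g \<Rightarrow> 'm \<Rightarrow> 'm) category)"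
  using cofree_normalized[OF assms] normalized_cofree_coring.equivalent_comodule_categories by blast

end
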